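(* Let $r>0$ be real, $q=e^{-\pi\sqrt r}$, and set $T=\sqrt{1-8V(q)^3}$. Then $$(k_r)^2=\frac{(1-T)(3+T)^3}{(1+T)(3-T)^3}.$$
   Context: $K(x)=\int_0^{\pi/2}\frac{dt}{\sqrt{1-x^2\sin^2 t}}$ for $0\le x<1$. For real $r>0$, $k_r\in(0,1)$ is the unique solution $k$ of $K(\sqrt{1-k^2})/K(k)=\sqrt r$. Ramanujan's cubic continued fraction is, for $0<q<1$ (with the positive cube root $q^{1/3}$), $$V(q)=\cfrac{q^{1/3}}{1+\cfrac{q+q^2}{1+\cfrac{q^2+q^4}{1+\cfrac{q^3+q^6}{1+\cdots}}}}.$$ *)

theory Defs
  imports "HOL-Analysis.Analysis"
begin

definition ellK :: "real \<Rightarrow> real" where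
  "ellK x = integral {0..pi/2} (\<lambda>t. 1 / sqrt (1 - x\<^sup>2 * (sin t)\<^sup>2))"

text \<open>Meaningful for r > 0, where the description determines a unique modulus.\<close>

definition singular_modulus :: "real \<Rightarrow> real" where
  "singular_modulus r =
     (THE k. 0 < k \<and> k < 1 \<and> ellK (sqrt (1 - k\<^sup>2)) / ellK k = sqrt r)"

text \<open>The finite continued fraction
  a m / (1 + a (m + 1) / (1 + ... + a (m + n - 1) / 1)) with n partial numerators,
  starting at index m.\<close>

fun cfrac_from :: "(nat \<Rightarrow> real) \<Rightarrow> nat \<Rightarrow> nat \<Rightarrow> real" where
  "cfrac_from a m 0 = 0"
| "cfrac_from a m (Suc n) = a m / (1 + cfrac_from a (Suc m) n)"

definition cubic_numerator :: "real \<Rightarrow> nat \<Rightarrow> real" where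
  "cubic_numerator q m = (if m = 0 then root 3 q else q ^ m + q ^ (2 * m))"

text \<open>The infinite continued fraction is the limit of its convergents; it is
  intended for 0 < q < 1.\<close>

definition cubic_cfrac :: "real \<Rightarrow> real" where
  "cubic_cfrac q = lim (\<lambda>n. cfrac_from (cubic_numerator q) 0 n)"

end

theory Submission imports Defs begin

text \<open>
  The partial numerators of the continued fraction are q^m + q^(2m), and its convergents satisfy
  the recurrence X (n+1) = X n + (q^n + q^(2n)) X (n-1). Alternating sums of q-trinomial coefficients,
  the coefficient with index 3r + e weighted by (-1)^r q^(3r^2 + 2er), solve this recurrence: all other
  terms of the trinomial recurrence telescope over r. As n grows every q-trinomial coefficient tends to the
  same limit, so V(q) is q^(1/3) times the quotient of the weight series for e = 1 and e = 0.

  Reindexing double series gives v^2 + 2 w^2 v = w for v = V(q), w = V(q^2), hence T = 1 - 4 v w.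
  Under q \<mapsto> q^2 the modulus k built from T therefore undergoes Landen's transformation, which
  doubles K'/K. Iterating, k becomes asymptotic to 4 sqrt q, and K' grows like log (1/k); this forces
  K'/K = - log q / pi at the original q. No transformation formula for theta functions is needed.
\<close>

section \<open>Sums over the integers\<close>

text \<open>A single q-trinomial coefficient does not satisfy the recurrence of the convergents: a
  defect of two mirror-image terms remains. The symmetry d -> 1 - d of \<open>skew_trinomial\<close>
  matches the first term at b with the second term at b - 3. This is where the step 3 in the index
  comes from, and it forces the weights: neighbouring ones must have ratio -q^(2b - 3). The analytic
  facts rest on one device. A relation between the values at q and q^2 is iterated along q, q^2,
  q^4, ..., where limits can be read off the series. A nonpositive theta value or a zero of T would
  persist along this sequence, against the limit 1; so no product formula is used for positivity.
  The relation between V(q) and V(q^2) cannot be read off the alternating series at q alone: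
  products that collapse to series in q^2 pair an alternating series with one without signs. The
  latter are therefore carried along and eliminated at the end.\<close>

lemma has_sum_diff:
  fixes f g :: "'a \<Rightarrow> real"
  assumes "(f has_sum a) A" "(g has_sum b) A"
  shows "((\<lambda>x. f x - g x) has_sum (a - b)) A"
  using has_sum_add[OF assms(1), of "\<lambda>x. - g x" "- b"] assms(2) by (simp add: has_sum_uminus)

lemma has_sum_shift: "((\<lambda>j. f (j + c)) has_sum s) UNIV \<longleftrightarrow> (f has_sum s) (UNIV :: int set)"
  by (rule has_sum_reindex_bij_witness[of _ "\<lambda>j. j - c" "\<lambda>j. j + c"]) auto

lemma infsum_single:
  fixes f :: "'a \<Rightarrow> real"
  assumes "\<And>x. x \<noteq> a \<Longrightarrow> f x = 0"
  shows "infsum f UNIV = f a"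
  by (rule infsumI, rule has_sum_finite_neutralI[of "{a}"]) (use assms in auto)

lemma summable_on_int_bounded_support:
  fixes f :: "int \<Rightarrow> real"
  assumes "\<And>r. \<bar>r\<bar> > K \<Longrightarrow> f r = 0"
  shows "f summable_on UNIV"
proof -
  have "{r. f r \<noteq> 0} \<subseteq> {- K..K}"
    using assms by (force simp: not_less[symmetric])
  then have "finite {r. f r \<noteq> 0}"
    by (rule finite_subset) simp
  then show ?thesis
    by (intro finite_nonzero_values_imp_summable_on) simp
qed

text \<open>Tannery's theorem. The M-test makes the convergence of the finite partial sums uniform
  in n, so the limit in n and the limit over finite sets may be exchanged.\<close>

lemma tendsto_infsum_dominated:
  fixes f :: "nat \<Rightarrow> 'a \<Rightarrow> real"
  assumes lim: "\<And>x. (\<lambda>n. f n x) \<longlonglongrightarrow> g x"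
    and bound: "\<And>n x. \<bar>f n x\<bar> \<le> M x"
    and M: "M summable_on UNIV"
  shows "(\<lambda>n. \<Sum>\<^sub>\<infinity>x. f n x) \<longlonglongrightarrow> (\<Sum>\<^sub>\<infinity>x. g x)"
proof (rule swap_uniform_limit'[where S = UNIV and F = "finite_subsets_at_top UNIV"])
  show "uniform_limit UNIV (\<lambda>X n. \<Sum>x\<in>X. f n x) (\<lambda>n. \<Sum>\<^sub>\<infinity>x. f n x) (finite_subsets_at_top UNIV)"
    by (rule Weierstrass_m_test_general[OF _ M]) (use bound in auto)
  show "\<forall>\<^sub>F X in finite_subsets_at_top UNIV. (\<lambda>n. \<Sum>x\<in>X. f n x) \<longlonglongrightarrow> (\<Sum>x\<in>X. g x)"
    by (intro always_eventually allI tendsto_sum lim)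
  have "\<bar>g x\<bar> \<le> M x" for x
    by (rule tendsto_upperbound[OF tendsto_rabs[OF lim]]) (use bound in auto)
  then have "g summable_on UNIV"
    using Infinite_Sum.abs_summable_on_comparison_test'[OF M, of g] by (auto intro: abs_summable_summable)
  then show "((\<lambda>X. \<Sum>x\<in>X. g x) \<longlongrightarrow> (\<Sum>\<^sub>\<infinity>x. g x)) (finite_subsets_at_top UNIV)"
    using has_sum_infsum unfolding has_sum_def by blast
qed auto

lemma summable_powi_abs:
  fixes q :: real
  assumes "0 < q" "q < 1"
  shows "(\<lambda>j::int. q powi \<bar>j\<bar>) summable_on UNIV"
proof -
  have nat: "(\<lambda>n. q ^ n) summable_on (UNIV :: nat set)"
    using assms by (intro summable_nonneg_imp_summable_on summable_geometric) auto
  have "(\<lambda>j::int. q powi \<bar>j\<bar>) summable_on range int"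
    using nat by (subst summable_on_reindex) (auto simp: o_def)
  moreover have "(\<lambda>j::int. q powi \<bar>j\<bar>) summable_on range (\<lambda>n. - int n)"
    using nat by (subst summable_on_reindex) (auto simp: o_def inj_on_def)
  ultimately have "(\<lambda>j::int. q powi \<bar>j\<bar>) summable_on (range int \<union> range (\<lambda>n. - int n))"
    by (rule summable_on_union)
  moreover have "j \<in> range int \<union> range (\<lambda>n. - int n)" for j
    by (cases j rule: int_cases2) auto
  then have "range int \<union> range (\<lambda>n. - int n) = UNIV"
    by blast
  ultimately show ?thesis by simp
qed

lemma summable_on_product_UNIV:
  fixes f :: "'a \<Rightarrow> real" and g :: "'b \<Rightarrow> real"
  assumes "f summable_on UNIV" "g summable_on UNIV" "\<And>x. f x \<ge> 0" "\<And>y. g y \<ge> 0"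
  shows "(\<lambda>(x, y). f x * g y) summable_on UNIV"
proof -
  have "(\<lambda>(x, y). f x * g y) summable_on (SIGMA x:UNIV. UNIV)"
    by (rule summable_on_SigmaI[where g = "\<lambda>x. f x * infsum g UNIV"])
      (use assms in \<open>auto intro!: has_sum_cmult_right summable_on_cmult_left\<close>)
  then show ?thesis by simp
qed

lemma has_sum_product_UNIV:
  fixes f :: "'a \<Rightarrow> real" and g :: "'b \<Rightarrow> real"
  assumes f: "(\<lambda>x. \<bar>f x\<bar>) summable_on UNIV" and g: "(\<lambda>x. \<bar>g x\<bar>) summable_on UNIV"
  shows "((\<lambda>(x, y). f x * g y) has_sum (infsum f UNIV * infsum g UNIV)) UNIV"
proof -
  have fs: "f summable_on UNIV" and gs: "g summable_on UNIV"
    using f g by (auto intro: abs_summable_summable)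
  have "(\<lambda>(x, y). \<bar>f x\<bar> * \<bar>g y\<bar>) summable_on UNIV"
    by (rule summable_on_product_UNIV[OF f g]) simp_all
  then have "(\<lambda>z. norm (case z of (x, y) \<Rightarrow> f x * g y)) summable_on UNIV"
    by (simp add: case_prod_unfold abs_mult)
  then have "(\<lambda>z. case z of (x, y) \<Rightarrow> f x * g y) summable_on UNIV"
    by (rule abs_summable_summable)
  then have "((\<lambda>(x, y). f x * g y) has_sum (infsum f UNIV * infsum g UNIV)) (SIGMA x:UNIV. UNIV)"
    using has_sum_cmult_right[OF has_sum_infsum[OF gs]] has_sum_cmult_left[OF has_sum_infsum[OF fs]]
    by (intro has_sum_SigmaI[where g = "\<lambda>x. f x * infsum g UNIV"]) simp_all
  then show ?thesis by simp
qed

lemma even_powi_minus_one: "even r \<Longrightarrow> (- 1 :: real) powi r = 1"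
  by (auto simp: power_int_mult elim!: evenE)

lemma odd_powi_minus_one: "odd r \<Longrightarrow> (- 1 :: real) powi r = - 1"
  by (auto simp: power_int_add power_int_mult elim!: oddE)

lemma filterlim_two_power: "filterlim (\<lambda>n. 2 ^ n :: nat) at_top sequentially"
  by (rule filterlim_subseq) (simp add: strict_mono_def)

section \<open>A recurrence for q-trinomial coefficients\<close>

definition qfac :: "real \<Rightarrow> nat \<Rightarrow> real" where
  "qfac q n = (\<Prod>i<n. 1 - q ^ Suc i)"

text \<open>The value 0 at negative m makes rqfac_pred hold for every integer, without boundary cases.\<close>

definition rqfac :: "real \<Rightarrow> int \<Rightarrow> real" where
  "rqfac q m = (if m < 0 then 0 else 1 / qfac q (nat m))"

text \<open>Up to the factor \<open>qfac q n\<close> these are the terms of the Andrews-Baxter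
  q-trinomial, which tends to the coefficient of x^b in (1 + x + 1/x)^n as q -> 1. Summing over all
  integers, with the zeros of \<open>rqfac\<close> cutting off the support, makes shifts of j free
  of boundary terms.\<close>

definition qtrinomial_term :: "real \<Rightarrow> nat \<Rightarrow> int \<Rightarrow> int \<Rightarrow> real" where
  "qtrinomial_term q n b j =
     q powi (j * (j + b)) * rqfac q j * rqfac q (j + b) * rqfac q (int n - 2 * j - b)"

definition qtrinomial :: "real \<Rightarrow> nat \<Rightarrow> int \<Rightarrow> real" where
  "qtrinomial q n b = qfac q n * (\<Sum>\<^sub>\<infinity>j. qtrinomial_term q n b j)"

text \<open>Up to the factor qfac q (n - 1), this is the q-analogue of a trinomial coefficient centred at d = 1/2:
  the j-th term is q^(j(j+d)) [n-1, j] [n-j, j+d] in Gaussian binomials.\<close>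

definition skew_trinomial_term :: "real \<Rightarrow> nat \<Rightarrow> int \<Rightarrow> int \<Rightarrow> real" where
  "skew_trinomial_term q n d j = q powi (j * (j + d)) * (1 - q powi (int n - j)) *
     rqfac q j * rqfac q (j + d) * rqfac q (int n - 2 * j - d)"

definition skew_trinomial :: "real \<Rightarrow> nat \<Rightarrow> int \<Rightarrow> real" where
  "skew_trinomial q n d = (\<Sum>\<^sub>\<infinity>j. skew_trinomial_term q n d j)"

locale nome =
  fixes q :: real
  assumes q0: "0 < q" and q1: "q < 1"
begin

lemma qfac_Suc: "qfac q (Suc n) = qfac q n * (1 - q ^ Suc n)"
  by (simp add: qfac_def)

lemma qfac_pos: "qfac q n > 0"
proof -
  have "q ^ Suc i < 1" for i
    using q0 q1 by (intro power_Suc_less_one) auto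
  then show ?thesis
    unfolding qfac_def by (intro prod_pos) (auto simp del: power_Suc)
qed

lemma rqfac_pred: "rqfac q (m - 1) = (1 - q powi m) * rqfac q m"
proof (cases "m > 0")
  case True
  then obtain n where m: "m = int (Suc n)"
    by (metis gr0_implies_Suc zero_less_imp_eq_int)
  have "1 - q ^ Suc n \<noteq> 0"
    using q0 q1 power_Suc_less_one[of q n] by (auto simp del: power_Suc)
  moreover have "nat (int (Suc n) - 1) = n" "nat (int (Suc n)) = Suc n" "\<not> int (Suc n) < 0"
    "\<not> int (Suc n) - 1 < 0" "q powi int (Suc n) = q ^ Suc n"
    by (auto simp del: power_Suc of_nat_Suc simp add: power_int_of_nat)
  ultimately show ?thesis
    using qfac_pos[of n] by (simp add: rqfac_def m qfac_Suc del: power_Suc of_nat_Suc)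
next
  case False
  then show ?thesis
    by (cases "m = 0") (auto simp: rqfac_def)
qed

lemma rqfac_neg: "m < 0 \<Longrightarrow> rqfac q m = 0"
  by (simp add: rqfac_def)

lemma rqfac_nonneg: "rqfac q m \<ge> 0"
  using qfac_pos[of "nat m"] by (simp add: rqfac_def)

lemma rqfac_0 [simp]: "rqfac q 0 = 1"
  by (simp add: rqfac_def qfac_def)

lemma qtrinomial_term_support:
  "{j. qtrinomial_term q n b j \<noteq> 0} \<subseteq> {j. 0 \<le> j \<and> 0 \<le> j + b \<and> 2 * j + b \<le> int n}"
  by (force simp: qtrinomial_term_def rqfac_def split: if_splits)

lemma qtrinomial_term_summable: "qtrinomial_term q n b summable_on UNIV"
proof -
  have "finite {j. qtrinomial_term q n b j \<noteq> 0}"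
    by (rule finite_subset[OF qtrinomial_term_support])
      (rule finite_subset[of _ "{0..int n + \<bar>b\<bar>}"], auto)
  then show ?thesis
    by (intro finite_nonzero_values_imp_summable_on) simp
qed

lemma skew_trinomial_term_summable: "skew_trinomial_term q n d summable_on UNIV"
proof -
  have "{j. skew_trinomial_term q n d j \<noteq> 0} \<subseteq> {0..int n + \<bar>d\<bar>}"
    by (force simp: skew_trinomial_term_def rqfac_def split: if_splits)
  then have "finite {j. skew_trinomial_term q n d j \<noteq> 0}"
    by (rule finite_subset) simp
  then show ?thesis
    by (intro finite_nonzero_values_imp_summable_on) simp
qed

lemma qtrinomial_eq_0: "\<bar>b\<bar> > int n \<Longrightarrow> qtrinomial q n b = 0"
proof -
  assume "\<bar>b\<bar> > int n"
  then have "qtrinomial_term q n b j = 0" for j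
    using qtrinomial_term_support[of n b] by force
  then have "qtrinomial_term q n b = (\<lambda>_. 0)" by blast
  then show ?thesis by (simp add: qtrinomial_def)
qed

text \<open>The shift j -> j + d - 1 in the sum for 1 - d turns its first two \<open>rqfac\<close>
  arguments into j + d - 1 and j, so they agree with j and j + d up to order and one unit. What is
  left of the difference of the terms telescopes, with \<open>g\<close> as certificate.\<close>

lemma skew_trinomial_reflect: "skew_trinomial q n d = skew_trinomial q n (1 - d)"
proof -
  define g where "g = (\<lambda>j. q powi (j * (j + d) - j) * rqfac q (j - 1) * rqfac q (j + d - 1)
     * rqfac q (int n + 1 - 2 * j - d))"
  have g_sum: "g summable_on UNIV"
  proof -
    have "{j. g j \<noteq> 0} \<subseteq> {0..int n + 1 + \<bar>d\<bar>}"
      by (force simp: g_def rqfac_def split: if_splits)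
    then have "finite {j. g j \<noteq> 0}"
      by (rule finite_subset) simp
    then show ?thesis
      by (intro finite_nonzero_values_imp_summable_on) simp
  qed
  have eq: "skew_trinomial_term q n d j - skew_trinomial_term q n (1 - d) (j + (d - 1)) = g (j + 1) - g j" for j
  proof -
    define x y N where "x = q powi j" and "y = q powi (j + d)" and "N = q ^ n"
    \<comment> \<open>M is the largest third argument among the four terms compared. Thus
      \<open>rqfac_pred\<close> is used only downwards, and there is no division by a factor 1 - q^m
      that could vanish.\<close>
    define M where "M = int n + 1 - 2 * j - d"
    define Q where "Q = q powi (j * (j + d))"
    have nz: "q \<noteq> 0" "x \<noteq> 0" "y \<noteq> 0" using q0 by (auto simp: x_def y_def)
    have M: "q powi M = q * N / (x * y)"
      using nz by (simp add: M_def x_def y_def N_def power_int_add power_int_diff field_simps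
          power_int_mult mult.commute[of 2] power2_eq_square)
    have r1: "rqfac q (M - 1) = (1 - q * N / (x * y)) * rqfac q M"
      using rqfac_pred[of M] M by simp
    have r2: "rqfac q (M - 2) = (1 - N / (x * y)) * ((1 - q * N / (x * y)) * rqfac q M)"
      using rqfac_pred[of "M - 1"] M r1 nz by (simp add: power_int_diff)
    have r3: "rqfac q (j - 1) = (1 - x) * rqfac q j"
      using rqfac_pred[of j] by (simp add: x_def)
    have r4: "rqfac q (j + d - 1) = (1 - y) * rqfac q (j + d)"
      using rqfac_pred[of "j + d"] by (simp add: y_def)
    have e1: "skew_trinomial_term q n d j = Q * (1 - N / x) * rqfac q j * rqfac q (j + d) * rqfac q (M - 1)"
    proof -
      have "int n - 2 * j - d = M - 1"
        by (simp add: M_def)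
      then show ?thesis
        using nz by (simp add: skew_trinomial_term_def Q_def N_def x_def power_int_diff)
    qed
    have e2: "skew_trinomial_term q n (1 - d) (j + (d - 1)) =
        Q / x * (1 - q * N / y) * rqfac q (j + d - 1) * rqfac q j * rqfac q M"
    proof -
      have "(j + (d - 1)) * (j + (d - 1) + (1 - d)) = j * (j + d) - j"
        by (simp add: algebra_simps)
      moreover have "q powi (int n - (j + (d - 1))) = q * N / y"
        using nz by (simp add: y_def N_def power_int_diff power_int_add)
      moreover have "int n - 2 * (j + (d - 1)) - (1 - d) = M"
        by (simp add: M_def algebra_simps)
      ultimately show ?thesis
        using nz by (simp add: skew_trinomial_term_def Q_def x_def power_int_diff add_diff_eq)
    qed
    have e3: "g j = Q / x * rqfac q (j - 1) * rqfac q (j + d - 1) * rqfac q M"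
      using nz by (simp add: g_def Q_def x_def M_def power_int_diff)
    have e4: "g (j + 1) = Q * y * rqfac q j * rqfac q (j + d) * rqfac q (M - 2)"
    proof -
      have "(j + 1) * (j + 1 + d) - (j + 1) = j * (j + d) + (j + d)"
        by (simp add: algebra_simps)
      moreover have "int n + 1 - 2 * (j + 1) - d = M - 2"
        by (simp add: M_def)
      ultimately show ?thesis
        using nz by (simp add: g_def Q_def y_def power_int_add algebra_simps)
    qed
    show ?thesis
      unfolding e1 e2 e3 e4 r1 r2 r3 r4 using nz by (simp add: field_simps)
  qed
  have "((\<lambda>j. g (j + 1) - g j) has_sum 0) UNIV"
    using has_sum_diff[OF _ has_sum_infsum[OF g_sum], of "\<lambda>j. g (j + 1)" "infsum g UNIV"]
      has_sum_infsum[OF g_sum] by (simp add: has_sum_shift)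
  moreover have "((\<lambda>j. skew_trinomial_term q n d j - skew_trinomial_term q n (1 - d) (j + (d - 1))) has_sum
      (skew_trinomial q n d - skew_trinomial q n (1 - d))) UNIV"
    unfolding skew_trinomial_def
    by (intro has_sum_diff) (simp_all add: has_sum_shift[of _ "d - 1"] skew_trinomial_term_summable)
  ultimately show ?thesis
    using has_sum_unique unfolding eq by fastforce
qed

text \<open>The right side is the defect, whose two terms are exchanged by b -> -b. It cancels only
  after weighting and summing over b = 3r + e, in \<open>cubic_sum_recurrence\<close>.\<close>

lemma qtrinomial_recurrence:
  fixes m :: nat and b :: int
  defines "n \<equiv> Suc m"
  shows "qtrinomial q (Suc n) b - qtrinomial q n b - (q ^ n + q ^ (2 * n)) * qtrinomial q m b =
    qfac q m * (q powi (int n + 1 - b) * skew_trinomial q n (b - 1) + q powi (int n + 1 + b) * skew_trinomial q n (- b - 1))"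
proof -
  define F where "F = qfac q m"
  define N where "N = q ^ n"
  have F1: "qfac q n = F * (1 - N)"
    by (simp add: n_def F_def N_def qfac_Suc)
  have F2: "qfac q (Suc n) = F * (1 - N) * (1 - q * N)"
    by (simp add: F1 N_def qfac_Suc)
  \<comment> \<open>The shifts j - 1 and j + b make all five terms multiples of q^(j(j + b))
    \<open>rqfac q j * rqfac q (j + b) * rqfac q L\<close>, with \<open>L\<close> as below.\<close>
  have eq: "F * (1 - N) * (1 - q * N) * qtrinomial_term q (Suc n) b j
      - F * (1 - N) * qtrinomial_term q n b j
      - (N + N\<^sup>2) * (F * qtrinomial_term q m b (j - 1)) =
      F * q powi (int n + 1 - b) * skew_trinomial_term q n (b - 1) j
      + F * q powi (int n + 1 + b) * skew_trinomial_term q n (- b - 1) (j + b)" for j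
  proof -
    define x y where "x = q powi j" and "y = q powi (j + b)"
    define L where "L = int n + 1 - 2 * j - b"
    define Q where "Q = q powi (j * (j + b))"
    have nz: "q \<noteq> 0" "x \<noteq> 0" "y \<noteq> 0" using q0 by (auto simp: x_def y_def)
    have L: "q powi L = q * N / (x * y)"
      using nz by (simp add: L_def x_def y_def N_def power_int_add power_int_diff field_simps
          power_int_mult mult.commute[of 2] power2_eq_square)
    have r1: "rqfac q (L - 1) = (1 - q * N / (x * y)) * rqfac q L"
      using rqfac_pred[of L] L by simp
    have r2: "rqfac q (j - 1) = (1 - x) * rqfac q j"
      using rqfac_pred[of j] by (simp add: x_def)
    have r3: "rqfac q (j + b - 1) = (1 - y) * rqfac q (j + b)"
      using rqfac_pred[of "j + b"] by (simp add: y_def)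
    have e1: "qtrinomial_term q (Suc n) b j = Q * rqfac q j * rqfac q (j + b) * rqfac q L"
      by (simp add: qtrinomial_term_def Q_def L_def algebra_simps)
    have e2: "qtrinomial_term q n b j = Q * rqfac q j * rqfac q (j + b) * rqfac q (L - 1)"
      by (simp add: qtrinomial_term_def Q_def L_def algebra_simps)
    have e3: "qtrinomial_term q m b (j - 1) =
        Q * q / (x * y) * rqfac q (j - 1) * rqfac q (j + b - 1) * rqfac q L"
    proof -
      have "(j - 1) * (j - 1 + b) = j * (j + b) + 1 - j - (j + b)"
        by (simp add: algebra_simps)
      then have "q powi ((j - 1) * (j - 1 + b)) = Q * q / (x * y)"
        by (simp only: Q_def x_def y_def power_int_diff power_int_add_1 nz simp_thms
            divide_divide_eq_left)
      moreover have "int m - 2 * (j - 1) - b = L"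
        by (simp add: L_def n_def)
      ultimately show ?thesis
        by (simp add: qtrinomial_term_def algebra_simps)
    qed
    have e4: "skew_trinomial_term q n (b - 1) j =
        Q / x * (1 - N / x) * rqfac q j * rqfac q (j + b - 1) * rqfac q L"
    proof -
      have "j * (j + (b - 1)) = j * (j + b) - j"
        by (simp add: algebra_simps)
      moreover have "int n - 2 * j - (b - 1) = L"
        by (simp add: L_def)
      ultimately show ?thesis
        using nz by (simp add: skew_trinomial_term_def Q_def N_def x_def power_int_diff add_diff_eq)
    qed
    have e5: "skew_trinomial_term q n (- b - 1) (j + b) =
        Q / y * (1 - N / y) * rqfac q (j + b) * rqfac q (j - 1) * rqfac q L"
    proof -
      have "(j + b) * (j + b + (- b - 1)) = j * (j + b) - (j + b)"
        by (simp add: algebra_simps)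
      moreover have "int n - 2 * (j + b) - (- b - 1) = L"
        by (simp add: L_def)
      ultimately show ?thesis
        using nz by (simp add: skew_trinomial_term_def Q_def N_def y_def power_int_diff)
    qed
    have p1: "q powi (int n + 1 - b) = q * N * x / y"
      using nz by (simp add: x_def y_def N_def power_int_add power_int_diff)
    have p2: "q powi (int n + 1 + b) = q * N * y / x"
      using nz by (simp add: x_def y_def N_def power_int_add)
    \<comment> \<open>With the three \<open>rqfac\<close> values abstracted to r, s, t, only an
      identity of rational functions remains.\<close>
    have "F * (1 - N) * (1 - q * N) * (Q * r * s * t) - F * (1 - N) * (Q * r * s * ((1 - q * N / (x * y)) * t))
      - (N + N\<^sup>2) * (F * (Q * q / (x * y) * ((1 - x) * r) * ((1 - y) * s) * t)) =
      F * (q * N * x / y) * (Q / x * (1 - N / x) * r * ((1 - y) * s) * t) +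
      F * (q * N * y / x) * (Q / y * (1 - N / y) * s * ((1 - x) * r) * t)" for r s t
      using nz by (simp add: field_simps power2_eq_square)
    then show ?thesis
      unfolding e1 e2 e3 e4 e5 r1 r2 r3 p1 p2 .
  qed
  have hs: "((\<lambda>j. qtrinomial_term q k b (j + c)) has_sum infsum (qtrinomial_term q k b) UNIV) UNIV" for k c
    by (simp add: has_sum_shift qtrinomial_term_summable)
  have hx: "((\<lambda>j. skew_trinomial_term q n d (j + c)) has_sum skew_trinomial q n d) UNIV" for d c
    by (simp add: has_sum_shift skew_trinomial_term_summable skew_trinomial_def)
  have "((\<lambda>j. F * (1 - N) * (1 - q * N) * qtrinomial_term q (Suc n) b (j + 0)
      - F * (1 - N) * qtrinomial_term q n b (j + 0)
      - (N + N\<^sup>2) * (F * qtrinomial_term q m b (j + - 1))) has_sum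
      (F * (1 - N) * (1 - q * N) * infsum (qtrinomial_term q (Suc n) b) UNIV
      - F * (1 - N) * infsum (qtrinomial_term q n b) UNIV
      - (N + N\<^sup>2) * (F * infsum (qtrinomial_term q m b) UNIV))) UNIV"
    by (intro has_sum_diff has_sum_cmult_right hs)
  moreover have "((\<lambda>j. F * q powi (int n + 1 - b) * skew_trinomial_term q n (b - 1) (j + 0)
      + F * q powi (int n + 1 + b) * skew_trinomial_term q n (- b - 1) (j + b)) has_sum
      (F * q powi (int n + 1 - b) * skew_trinomial q n (b - 1)
      + F * q powi (int n + 1 + b) * skew_trinomial q n (- b - 1))) UNIV"
    by (intro has_sum_add has_sum_cmult_right hx)
  ultimately have "F * (1 - N) * (1 - q * N) * infsum (qtrinomial_term q (Suc n) b) UNIV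
      - F * (1 - N) * infsum (qtrinomial_term q n b) UNIV
      - (N + N\<^sup>2) * (F * infsum (qtrinomial_term q m b) UNIV) =
      F * q powi (int n + 1 - b) * skew_trinomial q n (b - 1)
      + F * q powi (int n + 1 + b) * skew_trinomial q n (- b - 1)"
    using has_sum_unique by (simp add: eq)
  moreover have "q ^ (2 * n) = N\<^sup>2"
    by (simp add: N_def power_mult mult.commute flip: power_mult)
  ultimately show ?thesis
    unfolding qtrinomial_def F1 F2 by (simp add: F_def[symmetric] N_def[symmetric] algebra_simps)
qed

end

section \<open>The continued fraction as a quotient of theta series\<close>

fun cfrac_tail :: "(nat \<Rightarrow> real) \<Rightarrow> nat \<Rightarrow> nat \<Rightarrow> real \<Rightarrow> real" where
  "cfrac_tail a m 0 x = x"
| "cfrac_tail a m (Suc n) x = a m / (1 + cfrac_tail a (Suc m) n x)"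

lemma cfrac_from_eq_tail: "cfrac_from a m n = cfrac_tail a m n 0"
  by (induction n arbitrary: m) auto

text \<open>\<open>cfrac_from\<close> unfolds at the outer end, while the recurrence of the
  convergents extends the fraction at the inner end. The free tail x mediates between the
  two.\<close>

lemma cfrac_tail_Suc: "cfrac_tail a m (Suc n) x = cfrac_tail a m n (a (m + n) / (1 + x))"
proof (induction n arbitrary: m)
  case (Suc n)
  have "cfrac_tail a m (Suc (Suc n)) x = a m / (1 + cfrac_tail a (Suc m) (Suc n) x)"
    by simp
  also have "cfrac_tail a (Suc m) (Suc n) x = cfrac_tail a (Suc m) n (a (Suc m + n) / (1 + x))"
    by (rule Suc.IH)
  finally show ?case by simp
qed simp

text \<open>The leading numerator \<open>a 0\<close>, here the cube root of q, is split off, so that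
  A and B obey the same recurrence and differ only in their initial values.\<close>

lemma cfrac_from_eq_ratio:
  fixes a A B :: "nat \<Rightarrow> real"
  assumes A: "A 0 = 0" "A 1 = 1" "\<And>m. A (Suc (Suc m)) = A (Suc m) + a (Suc m) * A m"
    and B: "B 0 = 1" "B 1 = 1" "\<And>m. B (Suc (Suc m)) = B (Suc m) + a (Suc m) * B m"
    and pos: "\<And>m. a (Suc m) \<ge> 0"
  shows "cfrac_from a 0 (Suc n) = a 0 * (A (Suc n) / B (Suc n))"
proof -
  have Bpos: "B m > 0 \<and> B (Suc m) > 0" for m
    by (induction m) (use B pos in \<open>auto simp: less_imp_le intro!: add_pos_nonneg\<close>)
  \<comment> \<open>The induction needs the Moebius form in x for every x >= 0, because one more
    level replaces x by \<open>a (Suc n) / (1 + x)\<close>.\<close>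
  have "cfrac_tail a 0 (Suc n) x = a 0 * ((A (Suc n) + x * A n) / (B (Suc n) + x * B n))"
    if "x \<ge> 0" for x
    using that
  proof (induction n arbitrary: x)
    case 0
    then show ?case using A B by simp
  next
    case (Suc n)
    let ?y = "a (Suc n) / (1 + x)"
    have y: "?y \<ge> 0" using Suc.prems pos by simp
    have x1: "1 + x \<noteq> 0" using Suc.prems by simp
    have "cfrac_tail a 0 (Suc (Suc n)) x = cfrac_tail a 0 (Suc n) ?y"
      by (subst cfrac_tail_Suc) simp
    also have "\<dots> = a 0 * ((A (Suc n) + ?y * A n) / (B (Suc n) + ?y * B n))"
      by (rule Suc.IH[OF y])
    also have "(A (Suc n) + ?y * A n) / (B (Suc n) + ?y * B n) =
        ((1 + x) * (A (Suc n) + ?y * A n)) / ((1 + x) * (B (Suc n) + ?y * B n))"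
      using x1 by simp
    also have "(1 + x) * (A (Suc n) + ?y * A n) = A (Suc (Suc n)) + x * A (Suc n)"
      using x1 by (simp add: A(3) field_simps)
    also have "(1 + x) * (B (Suc n) + ?y * B n) = B (Suc (Suc n)) + x * B (Suc n)"
      using x1 by (simp add: B(3) field_simps)
    finally show ?case .
  qed
  from this[of 0] show ?thesis
    by (simp add: cfrac_from_eq_tail del: cfrac_tail.simps)
qed

section \<open>Weighted q-trinomial sums and their recurrence\<close>

definition cubic_coeff :: "real \<Rightarrow> int \<Rightarrow> int \<Rightarrow> real" where
  "cubic_coeff q e r = (- 1) powi r * q powi (3 * r\<^sup>2 + 2 * e * r)"

text \<open>In Ramanujan's notation f(a, b) these are f(-q^3, -q^3) for e = 0 and f(-q, -q^5) for e
  = 1.\<close>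

definition cubic_theta :: "real \<Rightarrow> int \<Rightarrow> real" where
  "cubic_theta q e = (\<Sum>\<^sub>\<infinity>r. cubic_coeff q e r)"

definition cubic_sum :: "real \<Rightarrow> int \<Rightarrow> nat \<Rightarrow> real" where
  "cubic_sum q e n = (\<Sum>\<^sub>\<infinity>r. cubic_coeff q e r * qtrinomial q n (3 * r + e))"

text \<open>The companions of \<open>cubic_theta\<close> without signs. They serve as intermediate
  factors and are eliminated in \<open>cubic_cfrac_square\<close>.\<close>

definition cubic_theta_pos :: "real \<Rightarrow> int \<Rightarrow> real" where
  "cubic_theta_pos q e = (\<Sum>\<^sub>\<infinity>r. q powi (3 * r\<^sup>2 + 2 * e * r))"

text \<open>What remains of \<open>qtrinomial_term\<close> as n grows, once \<open>qfac q n\<close>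
  has cancelled the third \<open>rqfac\<close> factor. Combinatorially it counts partitions by their
  Durfee rectangle with sides j and j + b.\<close>

definition durfee_term :: "real \<Rightarrow> int \<Rightarrow> int \<Rightarrow> real" where
  "durfee_term q b j = q powi (j * (j + b)) * rqfac q j * rqfac q (j + b)"

definition durfee_sum :: "real \<Rightarrow> int \<Rightarrow> real" where
  "durfee_sum q b = (\<Sum>\<^sub>\<infinity>j. durfee_term q b j)"

lemma cubic_exponent_ge: "e = 0 \<or> e = 1 \<Longrightarrow> 3 * r\<^sup>2 + 2 * e * r \<ge> \<bar>r\<bar>" for r e :: int
proof -
  assume e: "e = 0 \<or> e = 1"
  have "\<bar>r\<bar> * (\<bar>r\<bar> - 1) \<ge> 0"
    by (cases "r = 0") auto
  then have "r\<^sup>2 \<ge> \<bar>r\<bar>"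
    by (simp add: algebra_simps power2_eq_square)
  then show ?thesis using e by auto
qed

lemma durfee_exponent: "0 \<le> j \<Longrightarrow> 0 \<le> j + b \<Longrightarrow> j * (j + b) \<ge> \<bar>j\<bar> - \<bar>b\<bar>" for j b :: int
proof -
  assume j: "0 \<le> j" "0 \<le> j + b"
  show ?thesis
  proof (cases "j = 0 \<or> j + b = 0")
    case False
    then have "(j - 1) * (j + b) \<ge> 0" using j by simp
    moreover have "(j + b) \<ge> \<bar>j\<bar> - \<bar>b\<bar>" using j by linarith
    ultimately show ?thesis by (simp add: algebra_simps)
  qed (use j in auto)
qed

context nome
begin

lemma skew_trinomial_eq_0: "\<bar>d\<bar> > int n \<Longrightarrow> skew_trinomial q n d = 0"
proof -
  assume "\<bar>d\<bar> > int n"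
  then have "skew_trinomial_term q n d j = 0" for j
    by (force simp: skew_trinomial_term_def rqfac_def)
  then have "skew_trinomial_term q n d = (\<lambda>_. 0)" by blast
  then show ?thesis by (simp add: skew_trinomial_def)
qed

lemma cubic_sum_summable:
  "(\<lambda>r. cubic_coeff q e r * qtrinomial q n (3 * r + e)) summable_on UNIV"
  by (rule summable_on_int_bounded_support[of "int n + \<bar>e\<bar>"]) (auto intro!: qtrinomial_eq_0)

lemma cubic_sum_recurrence:
  fixes m :: nat
  defines "n \<equiv> Suc m"
  shows "cubic_sum q e (Suc n) = cubic_sum q e n + (q ^ n + q ^ (2 * n)) * cubic_sum q e m"
proof -
  \<comment> \<open>The weighted second defect term. Reflection turns the first defect term into
    -h(r - 1), so the sum over r telescopes.\<close>
  define h where "h = (\<lambda>r. cubic_coeff q e r * qfac q m * (q powi (int n + 1 + (3 * r + e)) *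
    skew_trinomial q n (- (3 * r + e) - 1)))"
  have h: "h summable_on UNIV"
    by (rule summable_on_int_bounded_support[of "int n + \<bar>e\<bar> + 1"])
      (auto simp: h_def intro!: skew_trinomial_eq_0)
  have h_pred: "cubic_coeff q e r * qfac q m * (q powi (int n + 1 - (3 * r + e)) *
    skew_trinomial q n (3 * r + e - 1)) = - h (r + - 1)" for r
  proof -
    have **: "skew_trinomial q n (- (3 * (r - 1) + e) - 1) = skew_trinomial q n (3 * r + e - 1)"
      by (subst skew_trinomial_reflect) (simp add: algebra_simps)
    \<comment> \<open>With b = 3r + e, the exponents of neighbouring weights differ by 6r - 3 + 2e =
      2b - 3, which is exactly the gap between n + 1 + (b - 3) and n + 1 - b.\<close>
    have *: "cubic_coeff q e (r - 1) * q powi (int n + 1 + (3 * (r - 1) + e)) =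
        - (cubic_coeff q e r * q powi (int n + 1 - (3 * r + e)))"
    proof -
      have "q powi (3 * (r - 1)\<^sup>2 + 2 * e * (r - 1)) * q powi (int n + 1 + (3 * (r - 1) + e)) =
            q powi (3 * r\<^sup>2 + 2 * e * r) * q powi (int n + 1 - (3 * r + e))"
        using q0 by (simp add: power2_eq_square algebra_simps flip: power_int_add)
      moreover have "(- 1 :: real) powi (r - 1) = - ((- 1) powi r)"
        by (simp add: power_int_diff)
      ultimately show ?thesis
        by (simp add: cubic_coeff_def mult.assoc)
    qed
    have "h (r + - 1) = (cubic_coeff q e (r - 1) * q powi (int n + 1 + (3 * (r - 1) + e))) *
        (qfac q m * skew_trinomial q n (- (3 * (r - 1) + e) - 1))"
      by (simp add: h_def)
    then show ?thesis
      unfolding * ** by simp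
  qed
  have eq: "cubic_coeff q e r * qtrinomial q (Suc n) (3 * r + e)
     - cubic_coeff q e r * qtrinomial q n (3 * r + e)
     - (q ^ n + q ^ (2 * n)) * (cubic_coeff q e r * qtrinomial q m (3 * r + e)) = h r - h (r + - 1)" for r
  proof -
    have "cubic_coeff q e r * (qtrinomial q (Suc n) (3 * r + e)
     - qtrinomial q n (3 * r + e) - (q ^ n + q ^ (2 * n)) * qtrinomial q m (3 * r + e)) =
      cubic_coeff q e r * qfac q m * (q powi (int n + 1 - (3 * r + e)) * skew_trinomial q n (3 * r + e - 1)) + h r"
      unfolding n_def qtrinomial_recurrence by (simp add: h_def n_def algebra_simps)
    then show ?thesis
      unfolding h_pred by (simp add: algebra_simps)
  qed
  have "((\<lambda>r. cubic_coeff q e r * qtrinomial q (Suc n) (3 * r + e)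
     - cubic_coeff q e r * qtrinomial q n (3 * r + e)
     - (q ^ n + q ^ (2 * n)) * (cubic_coeff q e r * qtrinomial q m (3 * r + e))) has_sum
     (cubic_sum q e (Suc n) - cubic_sum q e n - (q ^ n + q ^ (2 * n)) * cubic_sum q e m)) UNIV"
    unfolding cubic_sum_def
    by (intro has_sum_diff has_sum_cmult_right has_sum_infsum cubic_sum_summable)
  moreover have "((\<lambda>r. h r - h (r + - 1)) has_sum (infsum h UNIV - infsum h UNIV)) UNIV"
    by (intro has_sum_diff has_sum_infsum h) (simp only: has_sum_shift has_sum_infsum[OF h])
  ultimately have "cubic_sum q e (Suc n) - cubic_sum q e n - (q ^ n + q ^ (2 * n)) * cubic_sum q e m
      = infsum h UNIV - infsum h UNIV"
    unfolding eq by (rule has_sum_unique)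
  then show ?thesis by simp
qed

lemma qtrinomial_0: "qtrinomial q 0 b = (if b = 0 then 1 else 0)"
proof (cases "b = 0")
  case True
  have "(\<Sum>\<^sub>\<infinity>j. qtrinomial_term q 0 b j) = qtrinomial_term q 0 b 0"
    by (rule infsum_single) (auto simp: True qtrinomial_term_def rqfac_def)
  then show ?thesis
    using True by (simp add: qtrinomial_def qtrinomial_term_def qfac_def rqfac_0)
qed (simp add: qtrinomial_eq_0)

lemma qtrinomial_1: "qtrinomial q 1 b = (if \<bar>b\<bar> \<le> 1 then 1 else 0)"
proof (cases "\<bar>b\<bar> \<le> 1")
  case True
  have rq1: "rqfac q 1 = 1 / (1 - q)" "qfac q 1 = 1 - q"
    by (simp_all add: rqfac_def qfac_def)
  \<comment> \<open>The support conditions 0 <= j, 0 <= j + b and 2j + b <= 1 leave exactly one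
    j.\<close>
  define k where "k = (if b = -1 then 1 else (0::int))"
  have "qtrinomial_term q 1 b j = 0" if "j \<noteq> k" for j
    using that True qtrinomial_term_support[of 1 b] by (force simp: k_def split: if_splits)
  then have "(\<Sum>\<^sub>\<infinity>j. qtrinomial_term q 1 b j) = qtrinomial_term q 1 b k"
    by (rule infsum_single)
  also have "\<dots> = rqfac q 1"
  proof -
    consider "b = 0" | "b = 1" | "b = -1" using True by linarith
    then show ?thesis
      by cases (simp_all add: k_def qtrinomial_term_def rqfac_0)
  qed
  finally show ?thesis
    using True q1 by (simp only: qtrinomial_def rq1) simp
next
  case False
  then show ?thesis
    using qtrinomial_eq_0[of 1 b] by simp
qed

text \<open>For r different from 0 the index 3r + e has absolute value at least 2, so only r = 0
  contributes. The residues e = 0 and e = 1 then give the initial values of denominators and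
  numerators.\<close>

lemma cubic_sum_initial:
  "cubic_sum q 0 0 = 1" "cubic_sum q 0 1 = 1" "cubic_sum q 1 0 = 0" "cubic_sum q 1 1 = 1"
proof -
  have *: "cubic_sum q e n = cubic_coeff q e 0 * qtrinomial q n e"
    if "\<And>r. r \<noteq> 0 \<Longrightarrow> qtrinomial q n (3 * r + e) = 0" for e n
    unfolding cubic_sum_def by (subst infsum_single[of 0]) (use that in auto)
  show "cubic_sum q 0 0 = 1" "cubic_sum q 1 0 = 0"
    using *[of 0 0] *[of 0 1] by (simp_all add: qtrinomial_0 cubic_coeff_def)
  have "\<not> \<bar>3 * r\<bar> \<le> 1" "\<not> \<bar>3 * r + 1\<bar> \<le> 1" if "r \<noteq> 0" for r :: int
    using that by presburger+
  then have "cubic_sum q 0 1 = cubic_coeff q 0 0 * qtrinomial q 1 0"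
    "cubic_sum q 1 1 = cubic_coeff q 1 0 * qtrinomial q 1 1"
    by (intro *; simp only: qtrinomial_1; simp)+
  then show "cubic_sum q 0 1 = 1" "cubic_sum q 1 1 = 1"
    by (simp_all only: qtrinomial_1) (simp_all add: cubic_coeff_def)
qed

section \<open>Products of theta series at q in terms of series at q^2\<close>

lemma powi_mono: "a \<le> b \<Longrightarrow> q powi b \<le> q powi a"
  using q0 q1 by (intro power_int_decreasing) auto

lemma cubic_pos_summable:
  assumes "e = 0 \<or> e = 1"
  shows "(\<lambda>r. q powi (3 * r\<^sup>2 + 2 * e * r)) summable_on UNIV"
proof (rule abs_summable_summable, rule Infinite_Sum.abs_summable_on_comparison_test')
  show "(\<lambda>r::int. q powi \<bar>r\<bar>) summable_on UNIV"
    by (rule summable_powi_abs[OF q0 q1])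
  show "norm (q powi (3 * r\<^sup>2 + 2 * e * r)) \<le> q powi \<bar>r\<bar>" for r
    using powi_mono[OF cubic_exponent_ge[OF assms]] q0 by simp
qed

lemma abs_cubic_coeff: "\<bar>cubic_coeff q e r\<bar> = q powi (3 * r\<^sup>2 + 2 * e * r)"
  using q0 by (simp add: cubic_coeff_def abs_mult power_int_abs)

lemma cubic_coeff_abs_summable:
  "e = 0 \<or> e = 1 \<Longrightarrow> (\<lambda>r. \<bar>cubic_coeff q e r\<bar>) summable_on UNIV"
  unfolding abs_cubic_coeff by (rule cubic_pos_summable)

lemma cubic_theta_pos_pos:
  assumes "e = 0 \<or> e = 1"
  shows "cubic_theta_pos q e > 0"
proof -
  have "(\<Sum>r\<in>{0::int}. q powi (3 * r\<^sup>2 + 2 * e * r)) \<le> cubic_theta_pos q e"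
    unfolding cubic_theta_pos_def
    by (rule finite_sum_le_infsum) (use cubic_pos_summable[OF assms] q0 in auto)
  then show ?thesis by simp
qed

lemma nome_square: "nome (q\<^sup>2)"
  using q0 q1 by unfold_locales (auto simp: power_less_one_iff)

lemma powi_double: "q\<^sup>2 powi k = q powi (2 * k)"
  by (simp add: power_int_mult)

text \<open>Symmetrizing in (r, s) kills the pairs with r + s odd; on the others r = m + n, s = m - n separates the
  quadratic form.\<close>

lemma cubic_theta_mult:
  assumes e: "e = 0 \<or> e = 1"
  shows "cubic_theta_pos q e * cubic_theta q e = cubic_theta (q\<^sup>2) e * cubic_theta (q\<^sup>2) 0"
proof -
  interpret sq: nome "q\<^sup>2" by (rule nome_square)
  define E where "E = (\<lambda>r. q powi (3 * r\<^sup>2 + 2 * e * r))"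
  have Eabs: "(\<lambda>r. \<bar>E r\<bar>) summable_on UNIV"
    using cubic_pos_summable[OF e] q0 by (simp add: E_def)
  have c: "cubic_coeff q e r = (- 1) powi r * E r" for r
    by (simp add: cubic_coeff_def E_def)
  have s1: "((\<lambda>(r, s). E r * cubic_coeff q e s) has_sum (cubic_theta_pos q e * cubic_theta q e)) UNIV"
    using has_sum_product_UNIV[OF Eabs cubic_coeff_abs_summable[OF e]]
    by (simp add: cubic_theta_pos_def cubic_theta_def E_def)
  have s2: "((\<lambda>(r, s). cubic_coeff q e r * E s) has_sum (cubic_theta q e * cubic_theta_pos q e)) UNIV"
    using has_sum_product_UNIV[OF cubic_coeff_abs_summable[OF e] Eabs]
    by (simp add: cubic_theta_pos_def cubic_theta_def E_def)
  define f where "f = (\<lambda>(r, s). ((- 1) powi s + (- 1) powi r) * (E r * E s))"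
  have f0: "f (r, s) = 0" if "odd (r + s)" for r s
    using that by (cases "even r") (simp_all add: f_def even_powi_minus_one odd_powi_minus_one)
  have "((\<lambda>z. (case z of (r, s) \<Rightarrow> E r * cubic_coeff q e s) + (case z of (r, s) \<Rightarrow> cubic_coeff q e r * E s))
      has_sum (cubic_theta_pos q e * cubic_theta q e + cubic_theta q e * cubic_theta_pos q e)) UNIV"
    by (rule has_sum_add[OF s1 s2])
  then have "(f has_sum (2 * (cubic_theta_pos q e * cubic_theta q e))) UNIV"
    by (simp add: f_def c case_prod_unfold algebra_simps)
  also have "?this \<longleftrightarrow> (f has_sum (2 * (cubic_theta_pos q e * cubic_theta q e))) {(r, s). even (r + s)}"
    by (rule has_sum_cong_neutral) (use f0 in auto)
  also have "\<dots> \<longleftrightarrow> ((\<lambda>(m, n). 2 * (cubic_coeff (q\<^sup>2) e m * cubic_coeff (q\<^sup>2) 0 n)) has_sum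
      (2 * (cubic_theta_pos q e * cubic_theta q e))) UNIV"
  proof (rule sym, rule has_sum_reindex_bij_witness[of _ "\<lambda>(r, s). ((r + s) div 2, (r - s) div 2)" "\<lambda>(m, n). (m + n, m - n)"])
    fix z :: "int \<times> int"
    obtain m n where z: "z = (m, n)" by fastforce
    define r s where rs: "r = m + n" "s = m - n"
    have "E r * E s = q powi (3 * r\<^sup>2 + 2 * e * r + (3 * s\<^sup>2 + 2 * e * s))"
      using q0 by (simp add: E_def power_int_add)
    \<comment> \<open>The linear part 2e(r + s) = 4em involves m alone, so the second factor is the
      e = 0 series for either value of e.\<close>
    also have "3 * r\<^sup>2 + 2 * e * r + (3 * s\<^sup>2 + 2 * e * s) = 2 * (3 * m\<^sup>2 + 2 * e * m) + 2 * (3 * n\<^sup>2)"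
      by (simp add: rs power2_eq_square algebra_simps)
    also have "q powi \<dots> = q\<^sup>2 powi (3 * m\<^sup>2 + 2 * e * m) * q\<^sup>2 powi (3 * n\<^sup>2)"
      using q0 by (simp add: powi_double power_int_add)
    finally have E: "E r * E s = q\<^sup>2 powi (3 * m\<^sup>2 + 2 * e * m) * q\<^sup>2 powi (3 * n\<^sup>2)" .
    have sg: "(- 1) powi s + (- 1) powi r = 2 * ((- 1) powi m * (- 1 :: real) powi n)"
      by (cases "even m"; cases "even n") (simp_all add: rs even_powi_minus_one odd_powi_minus_one)
    have "f (r, s) = 2 * (cubic_coeff (q\<^sup>2) e m * cubic_coeff (q\<^sup>2) 0 n)"
      by (simp add: f_def E sg cubic_coeff_def mult_ac)
    then show "f (case z of (m, n) \<Rightarrow> (m + n, m - n)) =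
        (case z of (m, n) \<Rightarrow> 2 * (cubic_coeff (q\<^sup>2) e m * cubic_coeff (q\<^sup>2) 0 n))"
      by (simp add: rs z)
  next
    have "(r + s) div 2 + (r - s) div 2 = r" "(r + s) div 2 - (r - s) div 2 = s"
      if "even (r + s)" for r s :: int
      using that by presburger+
    then show "(case case z of (r, s) \<Rightarrow> ((r + s) div 2, (r - s) div 2) of (m, n) \<Rightarrow> (m + n, m - n)) = z"
      if "z \<in> {(r, s). even (r + s)}" for z :: "int \<times> int"
      using that by (cases z) simp
  qed auto
  finally have L: "((\<lambda>(m, n). 2 * (cubic_coeff (q\<^sup>2) e m * cubic_coeff (q\<^sup>2) 0 n)) has_sum
      (2 * (cubic_theta_pos q e * cubic_theta q e))) UNIV" .
  have "((\<lambda>z. 2 * (case z of (m, n) \<Rightarrow> cubic_coeff (q\<^sup>2) e m * cubic_coeff (q\<^sup>2) 0 n)) has_sum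
      (2 * (cubic_theta (q\<^sup>2) e * cubic_theta (q\<^sup>2) 0))) UNIV"
    unfolding cubic_theta_def
    by (intro has_sum_cmult_right has_sum_product_UNIV sq.cubic_coeff_abs_summable) (use e in auto)
  then have "((\<lambda>(m, n). 2 * (cubic_coeff (q\<^sup>2) e m * cubic_coeff (q\<^sup>2) 0 n)) has_sum
      (2 * (cubic_theta (q\<^sup>2) e * cubic_theta (q\<^sup>2) 0))) UNIV"
    by (simp add: case_prod_unfold)
  from has_sum_unique[OF L this] show ?thesis by simp
qed

text \<open>The difference kills the pairs with r + s even. Completing squares turns the exponent
  into ((3r + 1)^2 + (3s)^2 - 1)/3. On the remaining pairs r = -m - n - 1, s = n - m makes 3r + 1
  and 3s the negated sum and the difference of 3m + 1 and 3n + 1, so both new variables carry the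
  linear term of e = 1. The constants left over produce the factor q.\<close>

lemma cubic_theta_cross:
  "cubic_theta_pos q 1 * cubic_theta q 0 - cubic_theta q 1 * cubic_theta_pos q 0
     = 2 * q * (cubic_theta (q\<^sup>2) 1)\<^sup>2"
proof -
  interpret sq: nome "q\<^sup>2" by (rule nome_square)
  define E where "E = (\<lambda>e r. q powi (3 * r\<^sup>2 + 2 * e * r))"
  have Eabs: "(\<lambda>r. \<bar>E e r\<bar>) summable_on UNIV" if "e = 0 \<or> e = 1" for e
    using cubic_pos_summable[OF that] q0 by (simp add: E_def)
  have c: "cubic_coeff q e r = (- 1) powi r * E e r" for e r
    by (simp add: cubic_coeff_def E_def)
  define t where "t = cubic_theta_pos q 1 * cubic_theta q 0 - cubic_theta q 1 * cubic_theta_pos q 0"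
  have s1: "((\<lambda>(r, s). E 1 r * cubic_coeff q 0 s) has_sum (cubic_theta_pos q 1 * cubic_theta q 0)) UNIV"
    using has_sum_product_UNIV[OF Eabs cubic_coeff_abs_summable, of 1 0]
    by (simp add: cubic_theta_pos_def cubic_theta_def E_def)
  have s2: "((\<lambda>(r, s). cubic_coeff q 1 r * E 0 s) has_sum (cubic_theta q 1 * cubic_theta_pos q 0)) UNIV"
    using has_sum_product_UNIV[OF cubic_coeff_abs_summable Eabs, of 1 0]
    by (simp add: cubic_theta_pos_def cubic_theta_def E_def)
  define f where "f = (\<lambda>(r, s). ((- 1) powi s - (- 1) powi r) * (E 1 r * E 0 s))"
  have f0: "f (r, s) = 0" if "even (r + s)" for r s
    using that by (cases "even r") (simp_all add: f_def even_powi_minus_one odd_powi_minus_one)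
  have "((\<lambda>z. (case z of (r, s) \<Rightarrow> E 1 r * cubic_coeff q 0 s) - (case z of (r, s) \<Rightarrow> cubic_coeff q 1 r * E 0 s))
      has_sum t) UNIV"
    unfolding t_def by (rule has_sum_diff[OF s1 s2])
  then have "(f has_sum t) UNIV"
    by (simp add: f_def c case_prod_unfold algebra_simps)
  also have "?this \<longleftrightarrow> (f has_sum t) {(r, s). odd (r + s)}"
    by (rule has_sum_cong_neutral) (use f0 in auto)
  also have "\<dots> \<longleftrightarrow> ((\<lambda>(m, n). 2 * q * (cubic_coeff (q\<^sup>2) 1 m * cubic_coeff (q\<^sup>2) 1 n)) has_sum t) UNIV"
  proof (rule sym, rule has_sum_reindex_bij_witness[of _
        "\<lambda>(r, s). ((- r - s - 1) div 2, (s - r - 1) div 2)" "\<lambda>(m, n). (- m - n - 1, n - m)"])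
    fix z :: "int \<times> int"
    obtain m n where z: "z = (m, n)" by fastforce
    define r s where rs: "r = - m - n - 1" "s = n - m"
    have "E 1 r * E 0 s = q powi (3 * r\<^sup>2 + 2 * r + 3 * s\<^sup>2)"
      using q0 by (simp add: E_def power_int_add)
    also have "3 * r\<^sup>2 + 2 * r + 3 * s\<^sup>2 = 1 + 2 * (3 * m\<^sup>2 + 2 * m) + 2 * (3 * n\<^sup>2 + 2 * n)"
      by (simp add: rs power2_eq_square algebra_simps)
    also have "q powi \<dots> = q * q\<^sup>2 powi (3 * m\<^sup>2 + 2 * m) * q\<^sup>2 powi (3 * n\<^sup>2 + 2 * n)"
      using q0 by (simp only: powi_double) (simp add: power_int_add)
    finally have E: "E 1 r * E 0 s = q * q\<^sup>2 powi (3 * m\<^sup>2 + 2 * m) * q\<^sup>2 powi (3 * n\<^sup>2 + 2 * n)" .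
    have sg: "(- 1) powi s - (- 1) powi r = 2 * ((- 1) powi m * (- 1 :: real) powi n)"
      by (cases "even m"; cases "even n") (simp_all add: rs even_powi_minus_one odd_powi_minus_one)
    have "f (r, s) = 2 * q * (cubic_coeff (q\<^sup>2) 1 m * cubic_coeff (q\<^sup>2) 1 n)"
      by (simp add: f_def E sg cubic_coeff_def mult_ac)
    then show "f (case z of (m, n) \<Rightarrow> (- m - n - 1, n - m)) =
        (case z of (m, n) \<Rightarrow> 2 * q * (cubic_coeff (q\<^sup>2) 1 m * cubic_coeff (q\<^sup>2) 1 n))"
      by (simp add: rs z)
  next
    have "- ((- r - s - 1) div 2) - (s - r - 1) div 2 - 1 = r"
      "(s - r - 1) div 2 - (- r - s - 1) div 2 = s"
      if "odd (r + s)" for r s :: int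
      using that by presburger+
    then show "(case case z of (r, s) \<Rightarrow> ((- r - s - 1) div 2, (s - r - 1) div 2) of
        (m, n) \<Rightarrow> (- m - n - 1, n - m)) = z"
      if "z \<in> {(r, s). odd (r + s)}" for z :: "int \<times> int"
      using that by (cases z) simp
  qed auto
  finally have L: "((\<lambda>(m, n). 2 * q * (cubic_coeff (q\<^sup>2) 1 m * cubic_coeff (q\<^sup>2) 1 n)) has_sum t) UNIV" .
  have "((\<lambda>z. 2 * q * (case z of (m, n) \<Rightarrow> cubic_coeff (q\<^sup>2) 1 m * cubic_coeff (q\<^sup>2) 1 n)) has_sum
      (2 * q * (cubic_theta (q\<^sup>2) 1 * cubic_theta (q\<^sup>2) 1))) UNIV"
    unfolding cubic_theta_def
    by (intro has_sum_cmult_right has_sum_product_UNIV sq.cubic_coeff_abs_summable) auto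
  then have "((\<lambda>(m, n). 2 * q * (cubic_coeff (q\<^sup>2) 1 m * cubic_coeff (q\<^sup>2) 1 n)) has_sum
      (2 * q * (cubic_theta (q\<^sup>2) 1 * cubic_theta (q\<^sup>2) 1))) UNIV"
    by (simp add: case_prod_unfold)
  from has_sum_unique[OF L this] show ?thesis
    unfolding t_def power2_eq_square .
qed

section \<open>Positivity of the alternating theta series\<close>

lemma nome_iterate: "nome (q ^ 2 ^ n)"
  using q0 q1 by unfold_locales (auto simp: power_less_one_iff)

text \<open>Every term with r different from 0 vanishes in the limit, and q^(2^n) <= q provides one
  majorant for all n.\<close>

lemma cubic_theta_iterate_tendsto:
  assumes e: "e = 0 \<or> e = 1"
  shows "(\<lambda>n. cubic_theta (q ^ 2 ^ n) e) \<longlonglongrightarrow> 1"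
proof -
  have "(\<lambda>n. \<Sum>\<^sub>\<infinity>r. cubic_coeff (q ^ 2 ^ n) e r) \<longlonglongrightarrow> (\<Sum>\<^sub>\<infinity>r::int. if r = 0 then 1 else 0)"
  proof (rule tendsto_infsum_dominated)
    fix r :: int
    show "(\<lambda>n. cubic_coeff (q ^ 2 ^ n) e r) \<longlonglongrightarrow> (if r = 0 then 1 else 0)"
    proof (cases "r = 0")
      case False
      define k where "k = 3 * r\<^sup>2 + 2 * e * r"
      have k: "k > 0" using cubic_exponent_ge[OF e, of r] False by (simp add: k_def)
      have "(\<lambda>n. (q powi k) ^ n) \<longlonglongrightarrow> 0"
        by (rule LIMSEQ_power_zero) (use k q0 q1 power_int_strict_decreasing[of 0 k q] in simp)
      then have "(\<lambda>n. (q powi k) ^ 2 ^ n) \<longlonglongrightarrow> 0"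
        by (rule filterlim_compose[OF _ filterlim_two_power])
      then have "(\<lambda>n. (- 1) powi r * (q powi k) ^ 2 ^ n) \<longlonglongrightarrow> (- 1) powi r * 0"
        by (intro tendsto_intros)
      then show ?thesis
        using False by (simp add: cubic_coeff_def k_def power_int_power power_int_power' mult.commute)
    qed (simp add: cubic_coeff_def)
  next
    fix n :: nat and r :: int
    interpret qn: nome "q ^ 2 ^ n" by (rule nome_iterate)
    have "\<bar>cubic_coeff (q ^ 2 ^ n) e r\<bar> \<le> (q ^ 2 ^ n) powi \<bar>r\<bar>"
      unfolding qn.abs_cubic_coeff by (rule qn.powi_mono[OF cubic_exponent_ge[OF e]])
    also have "\<dots> \<le> q powi \<bar>r\<bar>"
      using q0 q1 power_decreasing[of 1 "2 ^ n" q] by (intro power_int_mono) auto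
    finally show "\<bar>cubic_coeff (q ^ 2 ^ n) e r\<bar> \<le> q powi \<bar>r\<bar>" .
  qed (rule summable_powi_abs[OF q0 q1])
  also have "(\<Sum>\<^sub>\<infinity>r::int. if r = 0 then 1 else 0 :: real) = 1"
    by (subst infsum_single[of 0]) auto
  finally show ?thesis by (simp add: cubic_theta_def)
qed

text \<open>\<open>cubic_theta_mult\<close> hands the sign on from q to q^2, as its other factor on
  the left is positive. For e = 0 the right side is a square, so no sign at q^2 has to be known
  beforehand; e = 1 then builds on e = 0.\<close>

lemma cubic_theta_nonpos_square:
  assumes e: "e = 0 \<or> e = 1" and th: "cubic_theta (q\<^sup>2) 0 > 0 \<or> e = 0" and le: "cubic_theta q e \<le> 0"
  shows "cubic_theta (q\<^sup>2) e \<le> 0"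
proof -
  have "cubic_theta (q\<^sup>2) e * cubic_theta (q\<^sup>2) 0 \<le> 0"
    using cubic_theta_mult[OF e] cubic_theta_pos_pos[OF e] le
    by (metis less_imp_le mult_nonneg_nonpos)
  then show ?thesis
    using th by (auto simp: mult_le_0_iff)
qed

lemma cubic_theta_0_pos: "cubic_theta q 0 > 0"
proof (rule ccontr)
  assume "\<not> cubic_theta q 0 > 0"
  then have 0: "cubic_theta q 0 \<le> 0" by simp
  have "cubic_theta (q ^ 2 ^ n) 0 \<le> 0" for n
  proof (induction n)
    case (Suc n)
    show ?case
      using nome.cubic_theta_nonpos_square[OF nome_iterate[of n], of 0] Suc
      by (simp add: mult.commute flip: power_mult)
  qed (simp add: 0)
  then have "(1 :: real) \<le> 0"
    by (intro LIMSEQ_le_const2[OF cubic_theta_iterate_tendsto[of 0]]) auto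
  then show False by simp
qed

lemma cubic_theta_1_pos: "cubic_theta q 1 > 0"
proof (rule ccontr)
  assume "\<not> cubic_theta q 1 > 0"
  then have 0: "cubic_theta q 1 \<le> 0" by simp
  have "cubic_theta (q ^ 2 ^ n) 1 \<le> 0" for n
  proof (induction n)
    case (Suc n)
    have "cubic_theta ((q ^ 2 ^ n)\<^sup>2) 0 > 0"
      by (intro nome.cubic_theta_0_pos nome.nome_square nome_iterate)
    then show ?case
      using nome.cubic_theta_nonpos_square[OF nome_iterate[of n], of 1] Suc
      by (simp add: mult.commute flip: power_mult)
  qed (simp add: 0)
  then have "(1 :: real) \<le> 0"
    by (intro LIMSEQ_le_const2[OF cubic_theta_iterate_tendsto[of 1]]) auto
  then show False by simp
qed

section \<open>Passage to the limit in the weighted sums\<close>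

definition qinf :: real where "qinf = prodinf (\<lambda>i. 1 - q ^ Suc i)"

lemma qfac_tendsto: "(\<lambda>n. qfac q n) \<longlonglongrightarrow> qinf" and qinf_pos: "qinf > 0"
proof -
  have lt: "q ^ Suc i < 1" for i
    using q0 q1 by (intro power_Suc_less_one) auto
  have "summable (\<lambda>i. norm (1 - q ^ Suc i - 1))"
    using q0 q1 summable_geometric[of q] by (simp add: abs_mult summable_mult)
  then have conv: "convergent_prod (\<lambda>i. 1 - q ^ Suc i)"
    using abs_convergent_prod_conv_summable abs_convergent_prod_imp_convergent_prod by blast
  have "(\<lambda>n. qfac q (Suc n)) \<longlonglongrightarrow> qinf"
    using convergent_prod_LIMSEQ[OF conv] by (simp add: qfac_def qinf_def lessThan_Suc_atMost del: power_Suc)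
  then show lim: "(\<lambda>n. qfac q n) \<longlonglongrightarrow> qinf"
    by (rule LIMSEQ_imp_Suc)
  have "qinf \<ge> 0"
    by (rule LIMSEQ_le_const[OF lim]) (use qfac_pos in \<open>auto intro: less_imp_le\<close>)
  moreover have "qinf \<noteq> 0"
    unfolding qinf_def by (rule prodinf_nonzero[OF conv]) (use lt in \<open>metis diff_gt_0_iff_gt less_irrefl\<close>)
  ultimately show "qinf > 0" by simp
qed

lemma qfac_antimono: "m \<le> n \<Longrightarrow> qfac q n \<le> qfac q m"
proof (rule lift_Suc_antimono_le)
  show "qfac q (Suc n) \<le> qfac q n" for n
    using qfac_pos[of n] q0 by (simp add: qfac_Suc mult_left_le)
qed

lemma qinf_le_qfac: "qinf \<le> qfac q n"
  by (rule LIMSEQ_le_const2[OF qfac_tendsto]) (use qfac_antimono in auto)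

lemma rqfac_le: "rqfac q m \<le> 1 / qinf"
  using qinf_pos qinf_le_qfac[of "nat m"] by (auto simp: rqfac_def frac_le)

lemma qfac_rqfac_tendsto: "(\<lambda>n. qfac q n * rqfac q (int n - c)) \<longlonglongrightarrow> 1"
proof -
  have "filterlim (\<lambda>n. nat (int n - c)) at_top sequentially"
    unfolding filterlim_at_top
  proof
    fix Z
    show "\<forall>\<^sub>F n in sequentially. Z \<le> nat (int n - c)"
      using eventually_ge_at_top[of "Z + nat \<bar>c\<bar>"] by eventually_elim auto
  qed
  then have "(\<lambda>n. qfac q (nat (int n - c))) \<longlonglongrightarrow> qinf"
    by (rule filterlim_compose[OF qfac_tendsto])
  then have "(\<lambda>n. qfac q n * (1 / qfac q (nat (int n - c)))) \<longlonglongrightarrow> qinf * (1 / qinf)"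
    using qinf_pos by (intro tendsto_intros qfac_tendsto) auto
  then have "(\<lambda>n. qfac q n * (1 / qfac q (nat (int n - c)))) \<longlonglongrightarrow> 1"
    using qinf_pos by simp
  moreover have "\<forall>\<^sub>F n in sequentially. qfac q n * (1 / qfac q (nat (int n - c))) =
      qfac q n * rqfac q (int n - c)"
    using eventually_ge_at_top[of "nat \<bar>c\<bar>"]
    by eventually_elim (auto simp: rqfac_def)
  ultimately show ?thesis
    by (rule Lim_transform_eventually)
qed

lemma durfee_term_nonneg: "durfee_term q b j \<ge> 0"
  using q0 rqfac_nonneg by (simp add: durfee_term_def)

lemma durfee_term_le: "durfee_term q b j \<le> (1 / qinf)\<^sup>2 * q powi (\<bar>j\<bar> - \<bar>b\<bar>)"
proof (cases "0 \<le> j \<and> 0 \<le> j + b")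
  case True
  have "durfee_term q b j \<le> q powi (\<bar>j\<bar> - \<bar>b\<bar>) * (1 / qinf) * (1 / qinf)"
    unfolding durfee_term_def
    using True q0 qinf_pos rqfac_nonneg rqfac_le
    by (intro mult_mono powi_mono durfee_exponent mult_nonneg_nonneg) auto
  then show ?thesis by (simp add: power2_eq_square mult_ac)
next
  case False
  then have "durfee_term q b j = 0"
    by (auto simp: durfee_term_def rqfac_neg)
  then show ?thesis using q0 by simp
qed

lemma durfee_term_summable: "durfee_term q b summable_on UNIV"
proof (rule summable_on_comparison_test)
  show "(\<lambda>j. (1 / qinf)\<^sup>2 * q powi (- \<bar>b\<bar>) * q powi \<bar>j\<bar>) summable_on UNIV"
    by (intro summable_on_cmult_right summable_powi_abs[OF q0 q1])
  show "durfee_term q b j \<le> (1 / qinf)\<^sup>2 * q powi (- \<bar>b\<bar>) * q powi \<bar>j\<bar>" for j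
    using durfee_term_le[of b j] q0 by (simp add: power_int_diff power_int_minus_divide)
qed (rule durfee_term_nonneg)

lemma q_nonzero: "q \<noteq> 0"
  using q0 by simp

text \<open>The terms differ by a telescoping one, so 1/(q;q) need not be evaluated: only independence of b matters.\<close>

lemma durfee_sum_step: "durfee_sum q b = durfee_sum q (b + 1)"
proof -
  \<comment> \<open>By \<open>rqfac_pred\<close> the factor 1 - q^j lowers \<open>rqfac q j\<close>
    to \<open>rqfac q (j - 1)\<close>. Written this way, \<open>g\<close> is dominated by
    \<open>durfee_term\<close>, which gives its summability.\<close>
  define g where "g = (\<lambda>j. - (1 - q powi j) * durfee_term q b j)"
  have g_sum: "g summable_on UNIV"
  proof (rule abs_summable_summable, rule Infinite_Sum.abs_summable_on_comparison_test'[OF durfee_term_summable[of b]])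
    fix j
    show "norm (g j) \<le> durfee_term q b j"
    proof (cases "j \<ge> 0")
      case True
      then have "0 \<le> q powi j" "q powi j \<le> 1"
        using q0 powi_mono[of 0 j] by auto
      then show ?thesis
        using durfee_term_nonneg[of b j] by (simp add: g_def abs_mult mult_left_le_one_le)
    qed (simp add: g_def durfee_term_def rqfac_neg)
  qed
  have eq: "durfee_term q b j - durfee_term q (b + 1) j = g (j + 1) - g j" for j
  proof -
    define x y Q where "x = q powi j" and "y = q powi (j + b)" and "Q = q powi (j * (j + b))"
    have e1: "durfee_term q b j = Q * rqfac q j * ((1 - q * y) * rqfac q (j + b + 1))"
      using rqfac_pred[of "j + b + 1"] q0 by (simp add: durfee_term_def Q_def y_def power_int_add)
    have e2: "durfee_term q (b + 1) j = Q * x * rqfac q j * rqfac q (j + b + 1)"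
      using q0 by (simp add: durfee_term_def Q_def x_def algebra_simps flip: power_int_add)
    have e3: "g (j + 1) = - (Q * q * x * y * rqfac q j * rqfac q (j + b + 1))"
    proof -
      have "(j + 1) * (j + 1 + b) = j * (j + b) + j + (j + b) + 1"
        by (simp add: algebra_simps)
      then have "q powi ((j + 1) * (j + 1 + b)) = Q * x * y * q"
        by (simp only: power_int_add[OF disjI1[OF q_nonzero]] Q_def x_def y_def power_int_1_right)
      moreover have "g (j + 1) = - (q powi ((j + 1) * (j + 1 + b)) *
          ((1 - q powi (j + 1)) * rqfac q (j + 1)) * rqfac q (j + b + 1))"
        by (simp add: g_def durfee_term_def add_ac) (simp add: algebra_simps)
      ultimately show ?thesis
        unfolding rqfac_pred[symmetric] by (simp add: mult_ac)
    qed
    have e4: "g j = - (1 - x) * (Q * rqfac q j * ((1 - q * y) * rqfac q (j + b + 1)))"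
      by (simp add: g_def x_def e1)
    show ?thesis
      unfolding e1 e2 e3 e4 by (simp add: algebra_simps)
  qed
  have "((\<lambda>j. durfee_term q b j - durfee_term q (b + 1) j) has_sum
      (durfee_sum q b - durfee_sum q (b + 1))) UNIV"
    unfolding durfee_sum_def by (intro has_sum_diff has_sum_infsum durfee_term_summable)
  moreover have "((\<lambda>j. g (j + 1) - g j) has_sum (infsum g UNIV - infsum g UNIV)) UNIV"
    by (intro has_sum_diff has_sum_infsum g_sum) (simp only: has_sum_shift has_sum_infsum[OF g_sum])
  ultimately have "durfee_sum q b - durfee_sum q (b + 1) = infsum g UNIV - infsum g UNIV"
    unfolding eq by (rule has_sum_unique)
  then show ?thesis by simp
qed

lemma durfee_sum_const: "durfee_sum q b = durfee_sum q 0"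
proof (induction b rule: int_induct[of _ 0])
  case (step1 i)
  then show ?case using durfee_sum_step[of i] by simp
next
  case (step2 i)
  then show ?case using durfee_sum_step[of "i - 1"] by simp
qed simp

lemma durfee_sum_pos: "durfee_sum q 0 > 0"
proof -
  have "(\<Sum>j\<in>{0}. durfee_term q 0 j) \<le> durfee_sum q 0"
    unfolding durfee_sum_def
    by (rule finite_sum_le_infsum) (use durfee_term_summable durfee_term_nonneg in auto)
  then show ?thesis by (simp add: durfee_term_def rqfac_0)
qed

text \<open>As a double series over (r, j), the finite sum differs from its limit only by a factor
  that lies in [0, 1] on the support and tends to 1. In the limit the inner sum is the same for all
  r by \<open>durfee_sum_const\<close>, so the double series factors.\<close>

lemma cubic_sum_tendsto:
  assumes e: "e = 0 \<or> e = 1"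
  shows "cubic_sum q e \<longlonglongrightarrow> cubic_theta q e * durfee_sum q 0"
proof -
  define f where "f = (\<lambda>n (r, j). cubic_coeff q e r * durfee_term q (3 * r + e) j *
     (qfac q n * rqfac q (int n - (2 * j + (3 * r + e)))))"
  define g where "g = (\<lambda>(r, j). cubic_coeff q e r * durfee_term q (3 * r + e) j)"
  \<comment> \<open>The exponent -4: from 3r^2 >= 6|r| - 3 and e <= 1, the quantity 3r^2 + 2er - |3r
    + e| is at least |r| - 4.\<close>
  define M where "M = (\<lambda>(r::int, j::int). (1 / qinf)\<^sup>2 * q powi (- 4) * (q powi \<bar>r\<bar> * q powi \<bar>j\<bar>))"
  have M: "M summable_on UNIV"
  proof -
    have "(\<lambda>z. (1 / qinf)\<^sup>2 * q powi (- 4) * (case z of (r, j) \<Rightarrow> q powi \<bar>r\<bar> * q powi \<bar>j\<bar>)) summable_on UNIV"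
      by (intro summable_on_cmult_right summable_on_product_UNIV summable_powi_abs q0 q1) (use q0 in auto)
    then show ?thesis by (simp add: M_def case_prod_unfold)
  qed
  have gM: "\<bar>g z\<bar> \<le> M z" for z
  proof -
    obtain r j where z: "z = (r, j)" by fastforce
    have "\<bar>g z\<bar> = q powi (3 * r\<^sup>2 + 2 * e * r) * durfee_term q (3 * r + e) j"
      using durfee_term_nonneg by (simp add: g_def z abs_mult abs_cubic_coeff)
    also have "\<dots> \<le> q powi (3 * r\<^sup>2 + 2 * e * r) * ((1 / qinf)\<^sup>2 * q powi (\<bar>j\<bar> - \<bar>3 * r + e\<bar>))"
      using q0 by (intro mult_left_mono durfee_term_le) auto
    also have "\<dots> = (1 / qinf)\<^sup>2 * q powi (3 * r\<^sup>2 + 2 * e * r + (\<bar>j\<bar> - \<bar>3 * r + e\<bar>))"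
      using q0 by (simp add: power_int_add)
    also have "\<dots> \<le> (1 / qinf)\<^sup>2 * q powi (- 4 + (\<bar>r\<bar> + \<bar>j\<bar>))"
    proof (intro mult_left_mono powi_mono)
      have "3 * (\<bar>r\<bar> - 1)\<^sup>2 \<ge> 0" by simp
      then have "3 * r\<^sup>2 \<ge> 6 * \<bar>r\<bar> - 3"
        by (simp add: power2_eq_square algebra_simps)
      then show "- 4 + (\<bar>r\<bar> + \<bar>j\<bar>) \<le> 3 * r\<^sup>2 + 2 * e * r + (\<bar>j\<bar> - \<bar>3 * r + e\<bar>)"
        using e by auto
    qed simp
    also have "\<dots> = M z"
      by (simp only: M_def z prod.case power_int_add[OF disjI1[OF q_nonzero]])
    finally show ?thesis .
  qed
  have fg: "\<bar>f n z\<bar> \<le> \<bar>g z\<bar>" for n z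
  proof -
    obtain r j where z: "z = (r, j)" by fastforce
    show ?thesis
    proof (cases "0 \<le> j \<and> 0 \<le> j + (3 * r + e)")
      case True
      \<comment> \<open>On the support 2j + 3r + e >= 0, so the denominator is \<open>qfac\<close>
        at an index at most n, hence at least \<open>qfac q n\<close>.\<close>
      have "qfac q n * rqfac q (int n - (2 * j + (3 * r + e))) \<le> 1"
      proof (cases "int n - (2 * j + (3 * r + e)) < 0")
        case False
        have "nat (int n - (2 * j + (3 * r + e))) \<le> n" using True by linarith
        then show ?thesis
          using False qfac_antimono[of "nat (int n - (2 * j + (3 * r + e)))" n] qfac_pos
          by (simp add: rqfac_def)
      qed (simp add: rqfac_neg)
      moreover have "0 \<le> qfac q n * rqfac q (int n - (2 * j + (3 * r + e)))"
        using qfac_pos[of n] rqfac_nonneg by simp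
      ultimately show ?thesis
        by (simp add: f_def g_def z abs_mult mult_left_le)
    next
      case False
      then have "durfee_term q (3 * r + e) j = 0"
        by (auto simp: durfee_term_def rqfac_neg)
      then show ?thesis by (simp add: f_def z)
    qed
  qed
  have sum_abs: "h summable_on UNIV" if "\<And>z. \<bar>h z\<bar> \<le> M z" for h :: "int \<times> int \<Rightarrow> real"
    by (rule abs_summable_summable, rule Infinite_Sum.abs_summable_on_comparison_test'[OF M])
      (use that in simp)
  have f_inf: "(\<Sum>\<^sub>\<infinity>z. f n z) = cubic_sum q e n" for n
  proof -
    have "f n summable_on UNIV"
      by (rule sum_abs) (use fg gM order_trans in blast)
    then have "f n summable_on (SIGMA r:UNIV. UNIV)" by simp
    from infsum_Sigma_banach[OF this]
    have "(\<Sum>\<^sub>\<infinity>z. f n z) = (\<Sum>\<^sub>\<infinity>r. \<Sum>\<^sub>\<infinity>j. f n (r, j))" by simp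
    moreover have "(\<Sum>\<^sub>\<infinity>j. f n (r, j)) = cubic_coeff q e r * qtrinomial q n (3 * r + e)" for r
    proof -
      have "f n (r, j) = cubic_coeff q e r * (qfac q n * qtrinomial_term q n (3 * r + e) j)" for j
        by (simp add: f_def durfee_term_def qtrinomial_term_def algebra_simps)
      then show ?thesis
        by (simp add: qtrinomial_def infsum_cmult_right')
    qed
    ultimately show ?thesis by (simp add: cubic_sum_def)
  qed
  have g_inf: "(\<Sum>\<^sub>\<infinity>z. g z) = cubic_theta q e * durfee_sum q 0"
  proof -
    have "g summable_on (SIGMA r:UNIV. UNIV)"
      using sum_abs[OF gM] by simp
    from infsum_Sigma_banach[OF this]
    have "(\<Sum>\<^sub>\<infinity>z. g z) = (\<Sum>\<^sub>\<infinity>r. \<Sum>\<^sub>\<infinity>j. g (r, j))" by simp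
    moreover have "(\<Sum>\<^sub>\<infinity>j. g (r, j)) = cubic_coeff q e r * durfee_sum q 0" for r
      using durfee_sum_const[of "3 * r + e"]
      by (simp add: g_def infsum_cmult_right' durfee_sum_def)
    ultimately show ?thesis by (simp add: cubic_theta_def infsum_cmult_left')
  qed
  have "(\<lambda>n. \<Sum>\<^sub>\<infinity>z. f n z) \<longlonglongrightarrow> (\<Sum>\<^sub>\<infinity>z. g z)"
  proof (rule tendsto_infsum_dominated[OF _ _ M])
    show "(\<lambda>n. f n z) \<longlonglongrightarrow> g z" for z
      using tendsto_mult_left[OF qfac_rqfac_tendsto, of "g z"]
      by (simp add: f_def g_def case_prod_unfold)
    show "\<bar>f n z\<bar> \<le> M z" for n z
      using fg[of n z] gM[of z] by simp
  qed
  then show ?thesis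
    by (simp add: f_inf g_inf)
qed

section \<open>Evaluation of the continued fraction and its relation between q and q^2\<close>

theorem cubic_cfrac_eq: "cubic_cfrac q = root 3 q * (cubic_theta q 1 / cubic_theta q 0)"
proof -
  have conv: "cfrac_from (cubic_numerator q) 0 (Suc n) = root 3 q * (cubic_sum q 1 (Suc n) / cubic_sum q 0 (Suc n))" for n
  proof -
    have "cfrac_from (cubic_numerator q) 0 (Suc n) =
        cubic_numerator q 0 * (cubic_sum q 1 (Suc n) / cubic_sum q 0 (Suc n))"
      by (rule cfrac_from_eq_ratio)
        (use cubic_sum_initial cubic_sum_recurrence q0 in \<open>simp_all add: cubic_numerator_def\<close>)
    then show ?thesis by (simp add: cubic_numerator_def)
  qed
  have "(\<lambda>n. root 3 q * (cubic_sum q 1 n / cubic_sum q 0 n)) \<longlonglongrightarrow>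
      root 3 q * ((cubic_theta q 1 * durfee_sum q 0) / (cubic_theta q 0 * durfee_sum q 0))"
    using cubic_theta_0_pos durfee_sum_pos by (intro tendsto_intros cubic_sum_tendsto) auto
  then have "(\<lambda>n. cfrac_from (cubic_numerator q) 0 (Suc n)) \<longlonglongrightarrow>
      root 3 q * (cubic_theta q 1 / cubic_theta q 0)"
    unfolding conv using durfee_sum_pos by (intro LIMSEQ_Suc) simp
  then have "cfrac_from (cubic_numerator q) 0 \<longlonglongrightarrow> root 3 q * (cubic_theta q 1 / cubic_theta q 0)"
    by (rule LIMSEQ_imp_Suc)
  then show ?thesis
    unfolding cubic_cfrac_def by (rule limI)
qed

lemma cubic_cfrac_pos: "cubic_cfrac q > 0"
  using cubic_theta_0_pos cubic_theta_1_pos q0 by (simp add: cubic_cfrac_eq)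

theorem cubic_cfrac_square:
  "(cubic_cfrac q)\<^sup>2 + 2 * (cubic_cfrac (q\<^sup>2))\<^sup>2 * cubic_cfrac q = cubic_cfrac (q\<^sup>2)"
proof -
  interpret sq: nome "q\<^sup>2" by (rule nome_square)
  define p where "p = root 3 q"
  define a b a2 b2 A B where "a = cubic_theta q 1" and "b = cubic_theta q 0"
    and "a2 = cubic_theta (q\<^sup>2) 1" and "b2 = cubic_theta (q\<^sup>2) 0"
    and "A = cubic_theta_pos q 1" and "B = cubic_theta_pos q 0"
  have p3: "p ^ 3 = q" using q0 by (simp add: p_def)
  have p2: "root 3 (q\<^sup>2) = p\<^sup>2" using q0 by (simp add: p_def real_root_power)
  have b: "b \<noteq> 0" "b2 \<noteq> 0"
    using cubic_theta_0_pos sq.cubic_theta_0_pos by (auto simp: b_def b2_def)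
  have Aa: "A * a = a2 * b2" and Bb: "B * b = b2 * b2" and cr: "A * b - a * B = 2 * q * a2\<^sup>2"
    using cubic_theta_mult[of 1] cubic_theta_mult[of 0] cubic_theta_cross
    by (simp_all add: a_def b_def a2_def b2_def A_def B_def)
  \<comment> \<open>Multiplying by a * b makes the unsigned series occur only as A * a and B * b,
    which are known in terms of q^2.\<close>
  have "a * b * (A * b - a * B) = a * b * (2 * q * a2\<^sup>2)"
    by (simp add: cr)
  then have "(A * a) * b\<^sup>2 - a\<^sup>2 * (B * b) = 2 * q * a2\<^sup>2 * a * b"
    by (simp add: power2_eq_square algebra_simps)
  then have key: "a2 * b2 * b\<^sup>2 - a\<^sup>2 * b2\<^sup>2 = 2 * p ^ 3 * a2\<^sup>2 * a * b"
    by (simp add: Aa Bb p3 power2_eq_square)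
  have "(p * (a / b))\<^sup>2 + 2 * (p\<^sup>2 * (a2 / b2))\<^sup>2 * (p * (a / b)) - p\<^sup>2 * (a2 / b2) =
      p\<^sup>2 * (a\<^sup>2 * b2\<^sup>2 + 2 * p ^ 3 * a2\<^sup>2 * a * b - a2 * b2 * b\<^sup>2) / (b\<^sup>2 * b2\<^sup>2)"
    using b by (simp add: field_simps power2_eq_square power3_eq_cube)
  also have "\<dots> = 0" using key by simp
  finally show ?thesis
    unfolding cubic_cfrac_eq sq.cubic_cfrac_eq p2 p_def[symmetric]
    by (simp add: a_def b_def a2_def b2_def)
qed

end

section \<open>The quotient of the complete elliptic integrals\<close>

text \<open>Gauss's homogeneous form of the complete integral, with K(k) =
  \<open>ellI 1 (sqrt (1 - k^2))\<close>. In it Landen's transformation is the invariance under one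
  step of the arithmetic-geometric mean.\<close>

definition ellI :: "real \<Rightarrow> real \<Rightarrow> real" where
  "ellI a b = integral {0..pi/2} (\<lambda>t. 1 / sqrt (a\<^sup>2 * (cos t)\<^sup>2 + b\<^sup>2 * (sin t)\<^sup>2))"

lemma ell_form_pos:
  fixes a b t :: real
  assumes "a > 0" "b > 0"
  shows "a\<^sup>2 * (cos t)\<^sup>2 + b\<^sup>2 * (sin t)\<^sup>2 > 0"
proof (cases "cos t = 0")
  case True
  then have "(sin t)\<^sup>2 = 1" using sin_cos_squared_add[of t] by simp
  then show ?thesis using assms True by simp
next
  case False
  then show ?thesis using assms by (intro add_pos_nonneg) auto
qed

lemma ell_continuous:
  assumes "a > 0" "b > 0"
  shows "continuous_on S (\<lambda>t. 1 / sqrt (a\<^sup>2 * (cos t)\<^sup>2 + b\<^sup>2 * (sin t)\<^sup>2))"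
  using ell_form_pos[OF assms] by (intro continuous_intros) (auto simp: less_imp_neq[symmetric])

lemma ell_integrable:
  assumes "a > 0" "b > 0"
  shows "(\<lambda>t. 1 / sqrt (a\<^sup>2 * (cos t)\<^sup>2 + b\<^sup>2 * (sin t)\<^sup>2)) integrable_on {c..d}"
  by (rule integrable_continuous_real[OF ell_continuous[OF assms]])

lemma ellK_eq_ellI:
  assumes "0 \<le> k" "k < 1"
  shows "ellK k = ellI 1 (sqrt (1 - k\<^sup>2))"
proof -
  have "k\<^sup>2 \<le> 1" using assms by (simp add: power_le_one)
  then have "1 - k\<^sup>2 * (sin t)\<^sup>2 = 1\<^sup>2 * (cos t)\<^sup>2 + (sqrt (1 - k\<^sup>2))\<^sup>2 * (sin t)\<^sup>2" for t
    by (simp add: cos_squared_eq algebra_simps)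
  then show ?thesis by (simp add: ellK_def ellI_def)
qed

lemma ell_interval_nonempty: "{0<..<pi/2} \<noteq> {}"
  by (metis greaterThanLessThan_empty_iff not_le pi_half_gt_zero)

lemma ellI_pos:
  assumes "a > 0" "b > 0"
  shows "ellI a b > 0"
proof -
  have "integral {0..pi/2} (\<lambda>t. 0) < ellI a b"
    unfolding ellI_def
    by (rule integral_less_real) (use ell_interval_nonempty ell_continuous[OF assms] ell_form_pos[OF assms] in \<open>auto simp del: greaterThanLessThan_empty_iff\<close>)
  then show ?thesis by simp
qed

lemma ellI_scale:
  assumes "c > 0"
  shows "ellI (c * a) (c * b) = ellI a b / c"
proof -
  have "1 / sqrt ((c * a)\<^sup>2 * (cos t)\<^sup>2 + (c * b)\<^sup>2 * (sin t)\<^sup>2) =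
      (1 / c) * (1 / sqrt (a\<^sup>2 * (cos t)\<^sup>2 + b\<^sup>2 * (sin t)\<^sup>2))" for t
  proof -
    have "(c * a)\<^sup>2 * (cos t)\<^sup>2 + (c * b)\<^sup>2 * (sin t)\<^sup>2 = c\<^sup>2 * (a\<^sup>2 * (cos t)\<^sup>2 + b\<^sup>2 * (sin t)\<^sup>2)"
      by (simp add: power_mult_distrib algebra_simps)
    then show ?thesis using assms by (simp add: real_sqrt_mult)
  qed
  then show ?thesis
    unfolding ellI_def by (simp only: integral_mult_right) simp
qed

lemma ellI_reflect:
  assumes "a > 0" "b > 0"
  shows "integral {pi/2..pi} (\<lambda>t. 1 / sqrt (a\<^sup>2 * (cos t)\<^sup>2 + b\<^sup>2 * (sin t)\<^sup>2)) = ellI a b"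
proof -
  let ?f = "\<lambda>t. 1 / sqrt (a\<^sup>2 * (cos t)\<^sup>2 + b\<^sup>2 * (sin t)\<^sup>2)"
  have "integral {pi/2..pi} ?f = integral {- pi..- (pi/2)} ?f"
    using Henstock_Kurzweil_Integration.integral_reflect_real[of pi "pi/2" ?f] by simp
  also have "\<dots> = integral {- pi..- (pi/2)} (?f \<circ> (\<lambda>t. t + pi))"
    by (simp add: o_def)
  also have "\<dots> = integral {- pi + pi..- (pi/2) + pi} ?f"
    by (rule integral_shift[OF ell_continuous[OF assms]])
  finally show ?thesis by (simp add: ellI_def)
qed

text \<open>Landen's substitution tan (g - t) = (b/a) tan t, written as g = 2t - arctan (h t) to stay smooth
  at \<pi>/2; it maps [0, \<pi>/2] onto [0, \<pi>].\<close>

lemma ellI_landen: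
  assumes a: "a > 0" and b: "b > 0"
  shows "ellI ((a + b) / 2) (sqrt (a * b)) = ellI a b"
proof -
  define A B where "A = (a + b) / 2" and "B = sqrt (a * b)"
  have A: "A > 0" and B: "B > 0" using assms by (auto simp: A_def B_def)
  have B2: "B\<^sup>2 = a * b" using assms by (simp add: B_def)
  define D where "D = (\<lambda>t. a\<^sup>2 * (cos t)\<^sup>2 + b\<^sup>2 * (sin t)\<^sup>2)"
  define E where "E = (\<lambda>t. a * (cos t)\<^sup>2 + b * (sin t)\<^sup>2)"
  \<comment> \<open>\<open>E t\<close> and (a - b) sin t cos t are the dot and cross products of (a
    cos t, b sin t) and (cos t, sin t). So \<open>arctan (h t)\<close> is the angle between these
    vectors, and \<open>D t\<close> is the squared length of the first.\<close>
  define h where "h = (\<lambda>t. (a - b) * (sin t * cos t) / E t)"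
  define g where "g = (\<lambda>t. 2 * t - arctan (h t))"
  let ?f = "\<lambda>t. 1 / sqrt (A\<^sup>2 * (cos t)\<^sup>2 + B\<^sup>2 * (sin t)\<^sup>2)"
  have D: "D t > 0" for t unfolding D_def by (rule ell_form_pos[OF a b])
  have E: "E t > 0" for t
    using ell_form_pos[of "sqrt a" "sqrt b" t] a b by (simp add: E_def)
  have sc: "(sin t)\<^sup>2 = 1 - (cos t)\<^sup>2" for t :: real by (simp add: sin_squared_eq)
  have DE: "(E t)\<^sup>2 + ((a - b) * (sin t * cos t))\<^sup>2 = D t" for t
    unfolding D_def E_def power_mult_distrib sc power2_sum by (simp add: sc power2_eq_square algebra_simps)
  have DE': "D t + a * b = (a + b) * E t" for t
    unfolding D_def E_def sc by (simp add: power2_eq_square algebra_simps)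
  have h1: "1 + (h t)\<^sup>2 = D t / (E t)\<^sup>2" for t
    using E[of t] DE[of t] by (simp add: h_def field_simps)
  have sD: "sqrt (1 + (h t)\<^sup>2) = sqrt (D t) / E t" for t
    using E[of t] by (simp add: h1 real_sqrt_divide)
  have deriv: "(g has_field_derivative (1 + a * b / D t)) (at t within S)" for t S
  proof -
    define s c where "s = sin t" and "c = cos t"
    have s2: "s\<^sup>2 = 1 - c\<^sup>2" by (simp add: s_def c_def sc)
    have hd: "(h has_field_derivative ((a - b) * (c * c - s * s) * E t - (a - b) * (s * c) *
        (2 * (b - a) * (s * c))) / (E t)\<^sup>2) (at t within S)"
      unfolding h_def E_def s_def c_def using E[of t, unfolded E_def]
      by (auto intro!: derivative_eq_intros simp: power2_eq_square) (simp add: algebra_simps)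
    have "(g has_field_derivative 2 - inverse (1 + (h t)\<^sup>2) * (((a - b) * (c * c - s * s) * E t - (a - b) * (s * c) *
        (2 * (b - a) * (s * c))) / (E t)\<^sup>2)) (at t within S)"
      unfolding g_def
      by (rule derivative_eq_intros refl DERIV_chain2[OF DERIV_arctan] hd)+ simp
    also have "2 - inverse (1 + (h t)\<^sup>2) * (((a - b) * (c * c - s * s) * E t - (a - b) * (s * c) *
        (2 * (b - a) * (s * c))) / (E t)\<^sup>2) = 1 + a * b / D t"
    proof -
      have "2 * D t - ((a - b) * (c * c - s * s) * E t - (a - b) * (s * c) * (2 * (b - a) * (s * c))) = D t + a * b"
        unfolding D_def E_def s_def[symmetric] c_def[symmetric] using s2 by algebra
      then have "2 - ((a - b) * (c * c - s * s) * E t - (a - b) * (s * c) * (2 * (b - a) * (s * c))) / D t = 1 + a * b / D t"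
        using D[of t] by (simp add: field_simps)
      then show ?thesis using D[of t] E[of t] by (simp add: h1)
    qed
    finally show ?thesis .
  qed
  have g0: "g 0 = 0" and gpi: "g (pi/2) = pi" by (simp_all add: g_def h_def)
  have mono: "g s \<le> g t" if "s \<le> t" for s t
    by (rule DERIV_nonneg_imp_nondecreasing[OF that])
      (use deriv D a b in \<open>metis add_nonneg_nonneg divide_nonneg_nonneg less_imp_le mult_nonneg_nonneg zero_le_one\<close>)
  \<comment> \<open>The factor 2 is matched on the other side by the range [0, pi], which covers the
    complete integral of (A, B) twice. The root becomes explicit because the radicand at
    \<open>g t\<close> is the square of \<open>A * E t\<close> divided by
    \<open>D t\<close>.\<close>
  have fg: "(1 + a * b / D t) * ?f (g t) = 2 / sqrt (D t)" for t
  proof -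
    define s c where "s = sin t" and "c = cos t"
    have s2: "s\<^sup>2 = 1 - c\<^sup>2" by (simp add: s_def c_def sc)
    have D0: "sqrt (D t) > 0" using D by simp
    have D2: "sqrt (D t) * sqrt (D t) = D t" using D[of t] by simp
    have ca: "cos (arctan (h t)) = E t / sqrt (D t)"
      by (simp add: cos_arctan sD)
    have sa: "sin (arctan (h t)) = (a - b) * (s * c) / sqrt (D t)"
    proof -
      have "sin (arctan (h t)) = h t / (sqrt (D t) / E t)"
        by (simp only: sin_arctan sD)
      then show ?thesis
        using E[of t] by (simp add: h_def s_def c_def)
    qed
    have cg: "cos (g t) = ((c\<^sup>2 - s\<^sup>2) * E t + 2 * s * c * ((a - b) * (s * c))) / sqrt (D t)"
      using D0 by (simp add: g_def cos_diff ca sa cos_double sin_double s_def c_def add_divide_distrib)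
    have sg: "sin (g t) = (2 * s * c * E t - (c\<^sup>2 - s\<^sup>2) * ((a - b) * (s * c))) / sqrt (D t)"
      using D0 by (simp add: g_def sin_diff ca sa cos_double sin_double s_def c_def diff_divide_distrib)
    have cg': "(c\<^sup>2 - s\<^sup>2) * E t + 2 * s * c * ((a - b) * (s * c)) = a * c\<^sup>2 - b * s\<^sup>2"
      unfolding E_def s_def[symmetric] c_def[symmetric] using s2 by algebra
    have sg': "2 * s * c * E t - (c\<^sup>2 - s\<^sup>2) * ((a - b) * (s * c)) = (a + b) * (s * c)"
      unfolding E_def s_def[symmetric] c_def[symmetric] using s2 by algebra
    have "A\<^sup>2 * (cos (g t))\<^sup>2 + B\<^sup>2 * (sin (g t))\<^sup>2 =
      (A\<^sup>2 * (a * c\<^sup>2 - b * s\<^sup>2)\<^sup>2 + a * b * ((a + b) * (s * c))\<^sup>2) / D t"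
      unfolding cg sg cg' sg' B2 using D[of t] by (simp add: power_divide add_divide_distrib)
    also have "A\<^sup>2 * (a * c\<^sup>2 - b * s\<^sup>2)\<^sup>2 + a * b * ((a + b) * (s * c))\<^sup>2 = (A * E t)\<^sup>2"
      unfolding A_def E_def s_def[symmetric] c_def[symmetric] by (simp add: field_simps power2_eq_square)
    finally have "sqrt (A\<^sup>2 * (cos (g t))\<^sup>2 + B\<^sup>2 * (sin (g t))\<^sup>2) = A * E t / sqrt (D t)"
      using A E[of t] by (simp add: real_sqrt_divide)
    then have "?f (g t) = sqrt (D t) / (A * E t)" by simp
    moreover have "1 + a * b / D t = 2 * A * E t / D t"
      using DE'[of t] D[of t] by (simp add: A_def field_simps)
    moreover have "sqrt (D t) / D t = 1 / sqrt (D t)"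
      using D0 D2 by (simp add: field_simps)
    ultimately show ?thesis using A E[of t] by simp
  qed
  have "((\<lambda>t. (1 + a * b / D t) *\<^sub>R ?f (g t)) has_integral integral {g 0..g (pi/2)} ?f) {0..pi/2}"
  proof (rule has_integral_substitution[where c = 0 and d = pi])
    show "g ` {0..pi/2} \<subseteq> {0..pi}"
      using mono g0 gpi by (metis atLeastAtMost_iff image_subsetI)
  qed (use deriv ell_continuous[OF A B] pi_ge_zero in \<open>auto simp: g0 gpi\<close>)
  moreover have "(\<lambda>t. (1 + a * b / D t) *\<^sub>R ?f (g t)) = (\<lambda>t. 2 * (1 / sqrt (D t)))"
    unfolding real_scaleR_def fg by simp
  ultimately have "((\<lambda>t. 2 * (1 / sqrt (D t))) has_integral integral {0..pi} ?f) {0..pi/2}"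
    by (simp only: g0 gpi)
  then have "integral {0..pi} ?f = integral {0..pi/2} (\<lambda>t. 2 * (1 / sqrt (D t)))"
    by (rule integral_unique[symmetric])
  then have "integral {0..pi} ?f = 2 * ellI a b"
    unfolding integral_mult_right by (simp add: D_def ellI_def)
  moreover have "integral {0..pi} ?f = ellI A B + ellI A B"
    using Henstock_Kurzweil_Integration.integral_combine[of 0 "pi/2" pi ?f] ell_integrable[OF A B, of 0 pi]
      ellI_reflect[OF A B] pi_ge_zero by (simp add: ellI_def)
  ultimately show ?thesis by (simp add: A_def B_def)
qed

section \<open>Monotonicity and logarithmic bounds of the integral\<close>

lemma ellI_antimono:
  assumes "0 < b" "b < c"
  shows "ellI 1 c < ellI 1 b"
  unfolding ellI_def
proof (rule integral_less_real)
  fix t :: real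
  assume t: "t \<in> {0<..<pi/2}"
  then have "sin t > 0" by (intro sin_gt_zero) auto
  then have "b\<^sup>2 * (sin t)\<^sup>2 < c\<^sup>2 * (sin t)\<^sup>2"
    using assms by (simp add: power_strict_mono)
  then show "1 / sqrt (1\<^sup>2 * (cos t)\<^sup>2 + c\<^sup>2 * (sin t)\<^sup>2) < 1 / sqrt (1\<^sup>2 * (cos t)\<^sup>2 + b\<^sup>2 * (sin t)\<^sup>2)"
    using ell_form_pos[of 1 b t] ell_form_pos[of 1 c t] assms by (intro divide_strict_left_mono) auto
next
  show "continuous_on {0..pi/2} (\<lambda>t. 1 / sqrt (1\<^sup>2 * (cos t)\<^sup>2 + c\<^sup>2 * (sin t)\<^sup>2))"
    "continuous_on {0..pi/2} (\<lambda>t. 1 / sqrt (1\<^sup>2 * (cos t)\<^sup>2 + b\<^sup>2 * (sin t)\<^sup>2))"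
    by (rule ell_continuous; use assms in simp)+
qed (rule ell_interval_nonempty)

lemma ellI_bounds:
  assumes b: "0 < b" "b < 1"
  shows "pi / 2 \<le> ellI 1 b" "ellI 1 b \<le> pi / 2 / b"
proof -
  let ?f = "\<lambda>t. 1 / sqrt (1\<^sup>2 * (cos t)\<^sup>2 + b\<^sup>2 * (sin t)\<^sup>2)"
  have b2: "b\<^sup>2 \<le> 1" using b by (simp add: power_le_one)
  have int: "?f integrable_on {0..pi/2}"
    by (rule ell_integrable) (use b in auto)
  have le: "1\<^sup>2 * (cos t)\<^sup>2 + b\<^sup>2 * (sin t)\<^sup>2 \<le> 1" for t
    using mult_right_mono[OF b2, of "(sin t)\<^sup>2"] by (simp add: cos_squared_eq)
  have ge: "b\<^sup>2 \<le> 1\<^sup>2 * (cos t)\<^sup>2 + b\<^sup>2 * (sin t)\<^sup>2" for t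
    using mult_right_mono[OF b2, of "(cos t)\<^sup>2"] by (simp add: sin_squared_eq algebra_simps)
  have "integral {0..pi/2} (\<lambda>t. 1) \<le> ellI 1 b"
    unfolding ellI_def
    by (rule integral_le[OF _ int]) (use le ell_form_pos[of 1 b] b in auto)
  then show "pi / 2 \<le> ellI 1 b" by simp
  have "?f t \<le> 1 / b" for t
    using b real_sqrt_le_mono[OF ge[of t]] ell_form_pos[of 1 b t]
    by (intro divide_left_mono mult_pos_pos) auto
  then have "ellI 1 b \<le> integral {0..pi/2} (\<lambda>t. 1 / b)"
    unfolding ellI_def by (intro integral_le[OF int]) auto
  then show "ellI 1 b \<le> pi / 2 / b" by simp
qed

text \<open>The comparison integral for the logarithmic bounds: the factor sin t makes the integrand
  an exact derivative. It is used with m = 1 below and m = sqrt (1 - k^2) above.\<close>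

lemma integral_sin_over_sqrt:
  assumes k: "k > 0" and m: "m > 0"
  shows "((\<lambda>t. sin t / sqrt (k\<^sup>2 + m\<^sup>2 * (cos t)\<^sup>2)) has_integral (arsinh (m / k) / m)) {0..pi/2}"
proof -
  define G where "G = (\<lambda>t. - (arsinh (m * cos t / k) / m))"
  have "((\<lambda>t. sin t / sqrt (k\<^sup>2 + m\<^sup>2 * (cos t)\<^sup>2)) has_integral (G (pi/2) - G 0)) {0..pi/2}"
  proof (rule fundamental_theorem_of_calculus)
    fix t :: real
    have "sqrt ((m * cos t / k)\<^sup>2 + 1) = sqrt (k\<^sup>2 + m\<^sup>2 * (cos t)\<^sup>2) / k"
    proof -
      have "(m * cos t / k)\<^sup>2 + 1 = (k\<^sup>2 + m\<^sup>2 * (cos t)\<^sup>2) / k\<^sup>2"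
        using k by (simp add: field_simps)
      then show ?thesis using k by (simp add: real_sqrt_divide)
    qed
    moreover have "(G has_real_derivative - (1 / sqrt ((m * cos t / k)\<^sup>2 + 1) * (m * (- sin t) / k) / m)) (at t within {0..pi/2})"
      unfolding G_def using k m
      by (auto intro!: derivative_eq_intros DERIV_chain2[OF arsinh_real_has_field_derivative])
    ultimately have "(G has_real_derivative sin t / sqrt (k\<^sup>2 + m\<^sup>2 * (cos t)\<^sup>2)) (at t within {0..pi/2})"
      using k m by simp
    then show "(G has_vector_derivative sin t / sqrt (k\<^sup>2 + m\<^sup>2 * (cos t)\<^sup>2)) (at t within {0..pi/2})"
      by (simp add: has_real_derivative_iff_has_vector_derivative)
  qed simp
  then show ?thesis by (simp add: G_def)
qed

text \<open>For small k the mass sits near pi/2, where sin t is close to 1, so inserting sin t costs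
  little. The lower bound uses sin t <= 1. For the upper bound, with d the root in the integrand, 1
  <= cos t + sin t <= d + sin t, so the loss is at most 1 pointwise and pi/2 in total.\<close>

lemma ellI_log_bounds:
  assumes k: "0 < k" "k < 1"
  shows "arsinh (1 / k) \<le> ellI 1 k"
    and "ellI 1 k \<le> pi / 2 + arsinh (1 / k) / sqrt (1 - k\<^sup>2)"
proof -
  define m where "m = sqrt (1 - k\<^sup>2)"
  have k2: "k\<^sup>2 < 1" using k by (simp add: power_less_one_iff)
  have m: "m > 0" "m\<^sup>2 = 1 - k\<^sup>2" "m \<le> 1" using k2 by (auto simp: m_def)
  let ?f = "\<lambda>t. 1 / sqrt (1\<^sup>2 * (cos t)\<^sup>2 + k\<^sup>2 * (sin t)\<^sup>2)"
  have fpos: "1\<^sup>2 * (cos t)\<^sup>2 + k\<^sup>2 * (sin t)\<^sup>2 > 0" for t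
    by (rule ell_form_pos) (use k in auto)
  have f: "(?f has_integral ellI 1 k) {0..pi/2}"
    unfolding ellI_def by (rule integrable_integral, rule ell_integrable) (use k in auto)
  have sc: "0 \<le> sin t" "sin t \<le> 1" "0 \<le> cos t" if "t \<in> {0..pi/2}" for t
    using that by (auto intro: sin_ge_zero cos_ge_zero)
  show "arsinh (1 / k) \<le> ellI 1 k"
  proof (rule has_integral_le[OF _ f])
    show "((\<lambda>t. sin t / sqrt (k\<^sup>2 + 1\<^sup>2 * (cos t)\<^sup>2)) has_integral arsinh (1 / k)) {0..pi/2}"
      using integral_sin_over_sqrt[of k 1] k by simp
    fix t :: real
    assume t: "t \<in> {0..pi/2}"
    have "k\<^sup>2 * (sin t)\<^sup>2 \<le> k\<^sup>2 * 1"
      using sc[OF t] by (intro mult_left_mono) (auto simp: power_le_one)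
    then have "1\<^sup>2 * (cos t)\<^sup>2 + k\<^sup>2 * (sin t)\<^sup>2 \<le> k\<^sup>2 + 1\<^sup>2 * (cos t)\<^sup>2" by simp
    then show "sin t / sqrt (k\<^sup>2 + 1\<^sup>2 * (cos t)\<^sup>2) \<le> ?f t"
      using sc[OF t] fpos[of t] by (intro frac_le) auto
  qed
  have "ellI 1 k \<le> pi / 2 + arsinh (m / k) / m"
  proof (rule has_integral_le[OF f])
    show "((\<lambda>t. 1 + sin t / sqrt (k\<^sup>2 + m\<^sup>2 * (cos t)\<^sup>2)) has_integral (pi / 2 + arsinh (m / k) / m)) {0..pi/2}"
      using has_integral_const_real[of "1::real" 0 "pi/2"] integral_sin_over_sqrt[OF k(1) m(1)]
      by (intro has_integral_add) auto
    fix t :: real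
    assume t: "t \<in> {0..pi/2}"
    have eq: "k\<^sup>2 + m\<^sup>2 * (cos t)\<^sup>2 = 1\<^sup>2 * (cos t)\<^sup>2 + k\<^sup>2 * (sin t)\<^sup>2"
      by (simp add: m sin_squared_eq algebra_simps)
    define d where "d = sqrt (1\<^sup>2 * (cos t)\<^sup>2 + k\<^sup>2 * (sin t)\<^sup>2)"
    have d: "d > 0" using fpos[of t] by (simp add: d_def)
    have "cos t \<le> d" unfolding d_def by (rule real_le_rsqrt) simp
    moreover have "1 \<le> cos t + sin t"
    proof -
      have "(cos t + sin t)\<^sup>2 = 1 + 2 * (sin t * cos t)"
        using sin_cos_squared_add[of t] by (simp add: power2_sum algebra_simps)
      then have "1\<^sup>2 \<le> (cos t + sin t)\<^sup>2" using sc[OF t] by simp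
      then show ?thesis by (rule power2_le_imp_le) (use sc[OF t] in auto)
    qed
    ultimately have "1 \<le> d + sin t" by simp
    then have "1 / d \<le> 1 + sin t / d" using d by (simp add: field_simps)
    then show "?f t \<le> 1 + sin t / sqrt (k\<^sup>2 + m\<^sup>2 * (cos t)\<^sup>2)"
      unfolding eq d_def .
  qed
  also have "arsinh (m / k) / m \<le> arsinh (1 / k) / m"
  proof -
    have "\<not> 1 / k < m / k" using m k by (simp add: divide_less_cancel)
    then have "arsinh (m / k) \<le> arsinh (1 / k)"
      using arsinh_less_iff_real[of "1 / k" "m / k"] by linarith
    then show ?thesis using m by (simp add: divide_right_mono)
  qed
  finally show "ellI 1 k \<le> pi / 2 + arsinh (1 / k) / sqrt (1 - k\<^sup>2)"
    by (simp add: m_def)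
qed

text \<open>The constant 3 comes from bounding the root by 2/k. Any constant disappears after
  division by 2^n in \<open>ell_ratio_eq_log\<close>.\<close>

lemma arsinh_inverse_bounds:
  fixes k :: real
  assumes k: "0 < k" "k < 1"
  shows "- ln k \<le> arsinh (1 / k)" "arsinh (1 / k) \<le> ln 3 - ln k"
proof -
  have "- ln k = ln (1 / k)" using k by (simp add: ln_div)
  also have "\<dots> \<le> ln (1 / k + sqrt ((1 / k)\<^sup>2 + 1))"
    using k by (subst ln_le_cancel_iff) (auto intro: add_pos_nonneg)
  finally show "- ln k \<le> arsinh (1 / k)" by (simp add: arsinh_real_def)
  have "sqrt ((1 / k)\<^sup>2 + 1) \<le> 2 / k"
  proof (rule real_le_lsqrt)
    have "1 \<le> (1 / k)\<^sup>2" using k by (simp add: one_le_power)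
    then show "(1 / k)\<^sup>2 + 1 \<le> (2 / k)\<^sup>2" by (simp add: power_divide)
  qed (use k in auto)
  then have "ln (1 / k + sqrt ((1 / k)\<^sup>2 + 1)) \<le> ln (3 / k)"
    using k by (subst ln_le_cancel_iff) (auto intro: add_pos_nonneg simp: field_simps)
  then show "arsinh (1 / k) \<le> ln 3 - ln k"
    using k by (simp add: arsinh_real_def ln_div)
qed

text \<open>This is K'/K: since \<open>ellI\<close> takes the complementary modulus as its second
  argument, the numerator is the complementary integral.\<close>

definition ell_ratio :: "real \<Rightarrow> real" where
  "ell_ratio k = ellI 1 k / ellI 1 (sqrt (1 - k\<^sup>2))"

lemma complementary_modulus:
  assumes "0 < k" "k < 1"
  shows "0 < sqrt (1 - k\<^sup>2)" "sqrt (1 - k\<^sup>2) < 1" "sqrt (1 - (sqrt (1 - k\<^sup>2))\<^sup>2) = k"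
proof -
  have "k\<^sup>2 < 1" using assms by (simp add: power_less_one_iff)
  then show "0 < sqrt (1 - k\<^sup>2)" "sqrt (1 - k\<^sup>2) < 1" "sqrt (1 - (sqrt (1 - k\<^sup>2))\<^sup>2) = k"
    using assms by auto
qed

lemma ell_ratio_antimono:
  assumes "0 < k" "k < l" "l < 1"
  shows "ell_ratio l < ell_ratio k"
proof -
  have k: "0 < k" "k < 1" and l: "0 < l" "l < 1" using assms by auto
  have "sqrt (1 - l\<^sup>2) < sqrt (1 - k\<^sup>2)"
    using assms by (simp add: power_strict_mono)
  then have "ellI 1 (sqrt (1 - k\<^sup>2)) < ellI 1 (sqrt (1 - l\<^sup>2))"
    using complementary_modulus(1)[OF l] by (rule ellI_antimono[rotated])
  moreover have "ellI 1 l < ellI 1 k"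
    using assms by (intro ellI_antimono) auto
  ultimately show ?thesis
    unfolding ell_ratio_def
    using ellI_pos[of 1 "sqrt (1 - k\<^sup>2)"] ellI_pos[of 1 l] complementary_modulus(1)[OF k] l
    by (intro frac_less) auto
qed

text \<open>Strict monotonicity of the ratio gives the uniqueness demanded by the description
  operator; k itself witnesses existence.\<close>

lemma singular_modulus_eqI:
  assumes k: "0 < k" "k < 1" and r: "ell_ratio k = sqrt r"
  shows "singular_modulus r = k"
proof -
  have eq: "ellK (sqrt (1 - l\<^sup>2)) / ellK l = ell_ratio l" if l: "0 < l" "l < 1" for l
    using complementary_modulus[OF l] l by (simp add: ellK_eq_ellI ell_ratio_def)
  show ?thesis
    unfolding singular_modulus_def
  proof (rule the_equality)
    fix l
    assume l: "0 < l \<and> l < 1 \<and> ellK (sqrt (1 - l\<^sup>2)) / ellK l = sqrt r"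
    then have "ell_ratio l = ell_ratio k" using eq[of l] r by simp
    then show "l = k"
      using ell_ratio_antimono[of l k] ell_ratio_antimono[of k l] k l by (cases l k rule: linorder_cases) auto
  qed (use k r eq in auto)
qed

text \<open>With l the new modulus, one arithmetic-geometric step from (1, c) leads to a multiple of
  (1, sqrt (1 - l^2)), and one from (1, l) to a multiple of (1, k). The integrals acquire the
  factors (1 + c)/2 and 1 + c, whose quotient is 2.\<close>

lemma ell_ratio_landen:
  assumes k: "0 < k" "k < 1"
  defines "c \<equiv> sqrt (1 - k\<^sup>2)"
  shows "ell_ratio ((1 - c) / (1 + c)) = 2 * ell_ratio k"
proof -
  have c: "0 < c" "c < 1" "c\<^sup>2 = 1 - k\<^sup>2"
    using complementary_modulus[OF k] k by (auto simp: c_def power_le_one)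
  define l where "l = (1 - c) / (1 + c)"
  have l: "0 < l" "l < 1" using c by (auto simp: l_def)
  have sl: "sqrt l = k / (1 + c)"
  proof -
    have "l = (k / (1 + c))\<^sup>2"
    proof -
      have "k\<^sup>2 = (1 - c) * (1 + c)" using c by (simp add: algebra_simps power2_eq_square)
      then show ?thesis using c by (simp add: l_def power_divide power2_eq_square)
    qed
    then show ?thesis using c k by simp
  qed
  have l': "sqrt (1 - l\<^sup>2) = 2 * sqrt c / (1 + c)"
  proof -
    have "1 - l\<^sup>2 = (2 * sqrt c / (1 + c))\<^sup>2"
    proof -
      have "(2 * sqrt c / (1 + c))\<^sup>2 = 4 * c / (1 + c)\<^sup>2"
        using c by (simp add: power_divide power_mult_distrib)
      moreover have "1 - l\<^sup>2 = ((1 + c)\<^sup>2 - (1 - c)\<^sup>2) / (1 + c)\<^sup>2"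
        unfolding l_def power_divide diff_divide_distrib[of "(1 + c)\<^sup>2"] using c by simp
      moreover have "(1 + c)\<^sup>2 - (1 - c)\<^sup>2 = 4 * c" by algebra
      ultimately show ?thesis by (simp only:)
    qed
    then show ?thesis using c by simp
  qed
  have "ellI 1 c = ellI ((1 + c) / 2) (sqrt c)"
    using ellI_landen[of 1 c] c by simp
  also have "\<dots> = ellI ((1 + c) / 2 * 1) ((1 + c) / 2 * sqrt (1 - l\<^sup>2))"
    using c by (simp add: l')
  also have "\<dots> = ellI 1 (sqrt (1 - l\<^sup>2)) / ((1 + c) / 2)"
    by (rule ellI_scale) (use c in simp)
  finally have 1: "ellI 1 (sqrt (1 - l\<^sup>2)) = (1 + c) / 2 * ellI 1 c"
    using c by simp
  have "ellI 1 l = ellI ((1 + l) / 2) (sqrt l)"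
    using ellI_landen[of 1 l] l by simp
  also have "\<dots> = ellI (1 / (1 + c) * 1) (1 / (1 + c) * k)"
  proof -
    have "(1 + l) / 2 = 1 / (1 + c)" using c by (simp add: l_def field_simps)
    then show ?thesis unfolding sl by (simp only:) simp
  qed
  also have "\<dots> = ellI 1 k / (1 / (1 + c))"
    by (rule ellI_scale) (use c in simp)
  finally have 2: "ellI 1 l = (1 + c) * ellI 1 k" by simp
  show ?thesis
    unfolding l_def[symmetric] ell_ratio_def 1 2 using c by (simp add: c_def[symmetric])
qed

text \<open>Each step doubles the ratio, so at the n-th step it is 2^n times the initial one, while it is asymptotic to
  - log (k n) / (\<pi>/2).\<close>

lemma ell_ratio_eq_log:
  fixes k :: "nat \<Rightarrow> real"
  assumes k: "\<And>n. 0 < k n" "\<And>n. k n < 1"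
    and step: "\<And>n. k (Suc n) = (1 - sqrt (1 - (k n)\<^sup>2)) / (1 + sqrt (1 - (k n)\<^sup>2))"
    and k0: "k \<longlonglongrightarrow> 0"
    and log: "(\<lambda>n. ln (k n) / 2 ^ n) \<longlonglongrightarrow> L"
  shows "ell_ratio (k 0) = - 2 * L / pi"
proof -
  define c where "c = (\<lambda>n. sqrt (1 - (k n)\<^sup>2))"
  have c: "0 < c n" "c n < 1" for n
    using complementary_modulus[OF k] by (auto simp: c_def)
  have c1: "c \<longlonglongrightarrow> 1"
    unfolding c_def using k0 by (auto intro!: tendsto_eq_intros)
  have ratio: "ell_ratio (k n) = 2 ^ n * ell_ratio (k 0)" for n
    by (induction n) (simp_all add: step ell_ratio_landen[OF k])
  have two: "(\<lambda>n. a / 2 ^ n) \<longlonglongrightarrow> 0" for a :: real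
    by (rule LIMSEQ_divide_realpow_zero) simp
  have lower: "- (ln (k n) / 2 ^ n) \<le> ellI 1 (k n) / 2 ^ n" for n
  proof -
    have "- ln (k n) \<le> ellI 1 (k n)"
      using ellI_log_bounds(1)[OF k] arsinh_inverse_bounds(1)[OF k] order_trans by blast
    then have "- ln (k n) / 2 ^ n \<le> ellI 1 (k n) / 2 ^ n" by (intro divide_right_mono) auto
    then show ?thesis by simp
  qed
  have upper: "ellI 1 (k n) / 2 ^ n \<le> pi / 2 / 2 ^ n + (ln 3 / 2 ^ n - ln (k n) / 2 ^ n) / c n" for n
  proof -
    have "ellI 1 (k n) \<le> pi / 2 + (ln 3 - ln (k n)) / c n"
      using ellI_log_bounds(2)[OF k, of n] divide_right_mono[OF arsinh_inverse_bounds(2)[OF k, of n], of "c n"] c[of n]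
      unfolding c_def by linarith
    then have "ellI 1 (k n) / 2 ^ n \<le> (pi / 2 + (ln 3 - ln (k n)) / c n) / 2 ^ n"
      by (intro divide_right_mono) auto
    then show ?thesis by (simp add: add_divide_distrib diff_divide_distrib mult.commute)
  qed
  have "(\<lambda>n. ellI 1 (k n) / 2 ^ n) \<longlonglongrightarrow> - L"
  proof (rule tendsto_sandwich[OF always_eventually always_eventually])
    show "(\<lambda>n. - (ln (k n) / 2 ^ n)) \<longlonglongrightarrow> - L"
      by (intro tendsto_intros log)
    have "(\<lambda>n. pi / 2 / 2 ^ n + (ln 3 / 2 ^ n - ln (k n) / 2 ^ n) / c n) \<longlonglongrightarrow> 0 + (0 - L) / 1"
      by (intro tendsto_intros two log c1) auto
    then show "(\<lambda>n. pi / 2 / 2 ^ n + (ln 3 / 2 ^ n - ln (k n) / 2 ^ n) / c n) \<longlonglongrightarrow> - L" by simp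
  qed (use lower upper in auto)
  \<comment> \<open>\<open>ellI 1 (c n)\<close> is K(k n), squeezed between pi/2 and pi/(2 c
    n).\<close>
  moreover have "(\<lambda>n. ellI 1 (c n)) \<longlonglongrightarrow> pi / 2"
  proof -
    have "(\<lambda>n. pi / 2 / c n) \<longlonglongrightarrow> pi / 2 / 1"
      by (intro tendsto_intros c1) auto
    then have lim: "(\<lambda>n. pi / 2 / c n) \<longlonglongrightarrow> pi / 2" by simp
    show ?thesis
      by (rule tendsto_sandwich[OF always_eventually always_eventually tendsto_const lim])
        (use ellI_bounds[OF c] in blast)+
  qed
  ultimately have "(\<lambda>n. ellI 1 (k n) / 2 ^ n / ellI 1 (c n)) \<longlonglongrightarrow> - L / (pi / 2)"
    by (intro tendsto_divide) auto
  moreover have "ellI 1 (k n) / 2 ^ n / ellI 1 (c n) = ell_ratio (k 0)" for n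
  proof -
    have "ellI 1 (k n) / 2 ^ n / ellI 1 (c n) = ell_ratio (k n) / 2 ^ n"
      by (simp add: ell_ratio_def c_def)
    then show ?thesis by (simp add: ratio[of n])
  qed
  ultimately have "- L / (pi / 2) = ell_ratio (k 0)"
    by (simp add: LIMSEQ_const_iff)
  then show ?thesis by (simp add: mult.commute)
qed

section \<open>The modulus attached to the continued fraction\<close>

definition cubic_T :: "real \<Rightarrow> real" where
  "cubic_T q = sqrt (1 - 8 * cubic_cfrac q ^ 3)"

text \<open>With p = (1 - T)/(1 + T) this is p (2 + p)^3 / (1 + 2p)^3, the classical parametrization
  of the modulus in the modular equation of degree 3.\<close>

definition cubic_modulus_sq :: "real \<Rightarrow> real" where
  "cubic_modulus_sq T = ((1 - T) * (3 + T) ^ 3) / ((1 + T) * (3 - T) ^ 3)"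

lemma cubic_modulus_sq_compl:
  assumes "0 < T" "T < 1"
  shows "1 - cubic_modulus_sq T = 16 * T ^ 3 / ((1 + T) * (3 - T) ^ 3)"
proof -
  have "(1 + T) * (3 - T) ^ 3 - (1 - T) * (3 + T) ^ 3 = 16 * T ^ 3" by algebra
  moreover have "(1 + T) * (3 - T) ^ 3 \<noteq> 0" using assms by simp
  ultimately show ?thesis
    unfolding cubic_modulus_sq_def by (simp add: field_simps)
qed

lemma cubic_modulus_sq_range:
  assumes T: "0 < T" "T < 1"
  shows "0 < cubic_modulus_sq T" "cubic_modulus_sq T < 1"
proof -
  show "0 < cubic_modulus_sq T"
    using T by (simp add: cubic_modulus_sq_def)
  have "0 < 1 - cubic_modulus_sq T"
    unfolding cubic_modulus_sq_compl[OF T] using T by simp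
  then show "cubic_modulus_sq T < 1" by simp
qed

text \<open>For l = (1 - c)/(1 + c) one has 1 - l^2 = 4c/(1 + c)^2, so it suffices to compare the
  complements, which have the short form of \<open>cubic_modulus_sq_compl\<close>.\<close>

lemma cubic_modulus_landen:
  assumes T: "0 < T" "T < 1" and S: "0 < S" "S < 1"
    and rel: "S\<^sup>2 * (1 + T) = T * (3 - T)"
  defines "c \<equiv> sqrt (1 - cubic_modulus_sq T)"
  shows "sqrt (cubic_modulus_sq S) = (1 - c) / (1 + c)"
proof -
  \<comment> \<open>By \<open>rel\<close>, T/(1 + T) = S^2/(3 - T), so 16 T^3 / ((1 + T)(3 - T)^3)
    is the square of this expression: S makes the complementary modulus rational.\<close>
  define d where "d = 4 * T * S / (3 - T)\<^sup>2"
  have d0: "d > 0" using T S by (simp add: d_def)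
  have "d\<^sup>2 * (1 + T) = 16 * T\<^sup>2 * (S\<^sup>2 * (1 + T)) / (3 - T) ^ 4"
    by (simp add: d_def power_divide power_mult_distrib flip: power_mult)
  also have "\<dots> = 16 * T ^ 3 / (3 - T) ^ 3"
  proof -
    have "16 * T\<^sup>2 * (T * p) / p ^ 4 = 16 * T ^ 3 / p ^ 3" if "p \<noteq> 0" for p
      using that by (simp add: power2_eq_square power3_eq_cube power4_eq_xxxx)
    then show ?thesis unfolding rel using T by simp
  qed
  finally have "d\<^sup>2 * (1 + T) / (1 + T) = 16 * T ^ 3 / (3 - T) ^ 3 / (1 + T)"
    by (rule arg_cong)
  then have "d\<^sup>2 = 1 - cubic_modulus_sq T"
    unfolding cubic_modulus_sq_compl[OF T] using T by (simp add: mult.commute)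
  then have c: "c = d"
    using d0 by (simp add: c_def real_sqrt_unique)
  have d1: "d < 1"
  proof -
    have "c < 1" using cubic_modulus_sq_range[OF T] by (simp add: c_def)
    then show ?thesis by (simp add: c)
  qed
  have main: "16 * S ^ 3 * (1 + d)\<^sup>2 = 4 * d * ((1 + S) * (3 - S) ^ 3)"
  proof -
    \<comment> \<open>\<open>rel\<close> involves S only through u. The identity is therefore split
      into its parts even and odd in S, which become \<open>e3\<close> and
      \<open>e4\<close>.\<close>
    define u where "u = S\<^sup>2"
    have "((3 - T)\<^sup>2 + 4 * T * S)\<^sup>2 = (1 + T) * (3 - T) * ((1 + S) * (3 - S) ^ 3)"
    proof -
      have r: "u * (1 + T) = T * (3 - T)" using rel by (simp add: u_def)
      have e1: "((3 - T)\<^sup>2 + 4 * T * S)\<^sup>2 = (3 - T) ^ 4 + 16 * T\<^sup>2 * u + 8 * T * (3 - T)\<^sup>2 * S"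
        unfolding u_def by algebra
      have e2: "(1 + S) * (3 - S) ^ 3 = 27 - 18 * u - u\<^sup>2 + 8 * u * S"
        unfolding u_def by algebra
      have e3: "(3 - T) ^ 4 + 16 * T\<^sup>2 * u = (1 + T) * (3 - T) * (27 - 18 * u - u\<^sup>2)"
      proof -
        \<comment> \<open>The extra factor 1 + T is there because \<open>r\<close> eliminates u only
          in the combination u (1 + T), and u occurs squared.\<close>
        have "(1 + T) * ((3 - T) ^ 4 + 16 * T\<^sup>2 * u) =
            (1 + T) * ((1 + T) * (3 - T) * (27 - 18 * u - u\<^sup>2))"
          using r by algebra
        then show ?thesis using T by simp
      qed
      have e4: "8 * T * (3 - T)\<^sup>2 = (1 + T) * (3 - T) * (8 * u)"
        using r by algebra
      have "(3 - T) ^ 4 + 16 * T\<^sup>2 * u + 8 * T * (3 - T)\<^sup>2 * S =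
          (1 + T) * (3 - T) * (27 - 18 * u - u\<^sup>2) + (1 + T) * (3 - T) * (8 * u) * S"
        by (simp only: e3 e4)
      then show ?thesis unfolding e1 e2 by (simp add: algebra_simps)
    qed
    note key = this
    have "16 * S ^ 3 * (1 + d)\<^sup>2 = 16 * S ^ 3 * ((3 - T)\<^sup>2 + 4 * T * S)\<^sup>2 / (3 - T) ^ 4"
    proof -
      have "1 + d = ((3 - T)\<^sup>2 + 4 * T * S) / (3 - T)\<^sup>2"
        using T by (simp add: d_def field_simps)
      then show ?thesis by (simp add: power_divide flip: power_mult)
    qed
    also have "\<dots> = 16 * S * (S\<^sup>2 * (1 + T)) * (3 - T) * ((1 + S) * (3 - S) ^ 3) / (3 - T) ^ 4"
      unfolding key by (simp add: power2_eq_square power3_eq_cube)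
    also have "\<dots> = 4 * d * ((1 + S) * (3 - S) ^ 3)"
    proof -
      have "16 * S * (T * p) * p * K / p ^ 4 = 4 * (4 * T * S / p\<^sup>2) * K" if "p \<noteq> 0" for p K
        using that by (simp add: power2_eq_square power4_eq_xxxx)
      then show ?thesis unfolding rel d_def using T by simp
    qed
    finally show ?thesis .
  qed
  have "1 - cubic_modulus_sq S = 4 * d / (1 + d)\<^sup>2"
    unfolding cubic_modulus_sq_compl[OF S] using S d0 main by (subst frac_eq_eq) simp_all
  then have "cubic_modulus_sq S = 1 - 4 * d / (1 + d)\<^sup>2" by simp
  also have "\<dots> = ((1 - d) / (1 + d))\<^sup>2"
    using d0 by (simp add: power_divide field_simps) (simp add: power2_eq_square algebra_simps)
  finally show ?thesis
    using d0 d1 c by simp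
qed

section \<open>The quantity T along q, q^2, q^4, ..\<close>

context nome
begin

text \<open>Multiplying the relation of V(q) and V(q^2) by 8 V(q) gives 8v^3 = 8vw - 16 v^2 w^2,
  which completes to a square.\<close>

lemma cubic_T_eq:
  "1 - 8 * cubic_cfrac q ^ 3 = (1 - 4 * cubic_cfrac q * cubic_cfrac (q\<^sup>2))\<^sup>2"
proof -
  define v w where "v = cubic_cfrac q" and "w = cubic_cfrac (q\<^sup>2)"
  have "v\<^sup>2 + 2 * w\<^sup>2 * v = w" using cubic_cfrac_square by (simp add: v_def w_def)
  then have "8 * v * (v\<^sup>2 + 2 * w\<^sup>2 * v) = 8 * v * w" by simp
  then have "1 - 8 * v ^ 3 = (1 - 4 * v * w)\<^sup>2"
    by (simp add: power2_eq_square power3_eq_cube algebra_simps)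
  then show ?thesis by (simp add: v_def w_def)
qed

text \<open>The square in \<open>cubic_T_eq\<close> forces 8 V(q)^3 <= 1. Applied at q and at q^2,
  the bound decides the sign of the root in \<open>cubic_T_rational\<close>.\<close>

lemma cubic_cfrac_le_half: "cubic_cfrac q \<le> 1 / 2"
proof (rule power_le_imp_le_base[of _ 2])
  have "8 * cubic_cfrac q ^ 3 \<le> 1" using cubic_T_eq by (metis diff_ge_0_iff_ge zero_le_power2)
  then show "cubic_cfrac q ^ Suc 2 \<le> (1 / 2) ^ Suc 2"
    by (simp add: power3_eq_cube)
qed simp

lemma cubic_T_rational: "cubic_T q = 1 - 4 * cubic_cfrac q * cubic_cfrac (q\<^sup>2)"
proof -
  interpret sq: nome "q\<^sup>2" by (rule nome_square)
  have "cubic_cfrac q * cubic_cfrac (q\<^sup>2) \<le> 1 / 2 * (1 / 2)"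
    using cubic_cfrac_pos sq.cubic_cfrac_pos cubic_cfrac_le_half sq.cubic_cfrac_le_half
    by (intro mult_mono) auto
  then show ?thesis
    by (simp add: cubic_T_def cubic_T_eq)
qed

text \<open>This is the hypothesis \<open>rel\<close> of \<open>cubic_modulus_landen\<close>, with S
  the value of T at q^2.\<close>

lemma cubic_T_relation:
  "(cubic_T (q\<^sup>2))\<^sup>2 * (1 + cubic_T q) = cubic_T q * (3 - cubic_T q)"
proof -
  interpret sq: nome "q\<^sup>2" by (rule nome_square)
  define v w where "v = cubic_cfrac q" and "w = cubic_cfrac (q\<^sup>2)"
  have vw: "v\<^sup>2 + 2 * w\<^sup>2 * v = w" using cubic_cfrac_square by (simp add: v_def w_def)
  have T: "cubic_T q = 1 - 4 * v * w" by (simp add: cubic_T_rational v_def w_def)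
  have "8 * w ^ 3 \<le> 1"
    using sq.cubic_T_eq by (metis diff_ge_0_iff_ge zero_le_power2 w_def)
  then have "(cubic_T (q\<^sup>2))\<^sup>2 = 1 - 8 * w ^ 3"
    by (simp add: cubic_T_def w_def)
  \<comment> \<open>The two sides differ by 16 w^2 times v^2 + 2 w^2 v - w.\<close>
  moreover have "(1 - 8 * w ^ 3) * (1 + (1 - 4 * v * w)) = (1 - 4 * v * w) * (3 - (1 - 4 * v * w))"
  proof -
    have "w * (v\<^sup>2 + 2 * w\<^sup>2 * v) = w\<^sup>2" using vw by (simp add: power2_eq_square)
    then show ?thesis using vw by algebra
  qed
  ultimately show ?thesis by (simp add: T)
qed

lemma cubic_ratio_iterate_tendsto:
  "(\<lambda>n. (cubic_theta (q ^ 2 ^ n) 1 / cubic_theta (q ^ 2 ^ n) 0) ^ 3) \<longlonglongrightarrow> 1"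
proof -
  have "(\<lambda>n. (cubic_theta (q ^ 2 ^ n) 1 / cubic_theta (q ^ 2 ^ n) 0) ^ 3) \<longlonglongrightarrow> (1 / 1) ^ 3"
    by (intro tendsto_intros cubic_theta_iterate_tendsto) auto
  then show ?thesis by simp
qed

lemma cubic_cfrac_cube: "cubic_cfrac q ^ 3 = q * (cubic_theta q 1 / cubic_theta q 0) ^ 3"
  using q0 by (simp add: cubic_cfrac_eq power_mult_distrib power_divide)

lemma cubic_cfrac_cube_iterate_tendsto: "(\<lambda>n. cubic_cfrac (q ^ 2 ^ n) ^ 3) \<longlonglongrightarrow> 0"
proof -
  have "(\<lambda>n. q ^ 2 ^ n) \<longlonglongrightarrow> 0"
    by (rule filterlim_compose[OF LIMSEQ_power_zero filterlim_two_power]) (use q0 q1 in auto)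
  then have "(\<lambda>n. q ^ 2 ^ n * (cubic_theta (q ^ 2 ^ n) 1 / cubic_theta (q ^ 2 ^ n) 0) ^ 3) \<longlonglongrightarrow> 0 * 1"
    by (intro tendsto_intros cubic_ratio_iterate_tendsto)
  then show ?thesis
    using nome.cubic_cfrac_cube[OF nome_iterate] by simp
qed

lemma cubic_T_iterate_tendsto: "(\<lambda>n. cubic_T (q ^ 2 ^ n)) \<longlonglongrightarrow> 1"
proof -
  have "(\<lambda>n. sqrt (1 - 8 * cubic_cfrac (q ^ 2 ^ n) ^ 3)) \<longlonglongrightarrow> sqrt (1 - 8 * 0)"
    by (intro tendsto_intros cubic_cfrac_cube_iterate_tendsto)
  then show ?thesis by (simp add: cubic_T_def)
qed

lemma cubic_T_less_1: "cubic_T q < 1"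
  using cubic_cfrac_pos by (simp add: cubic_T_def)

text \<open>In HOL \<open>sqrt\<close> is negative at negative arguments, so the sign has to come
  from the square in \<open>cubic_T_eq\<close>.\<close>

lemma cubic_T_nonneg: "cubic_T q \<ge> 0"
  using cubic_T_eq by (simp add: cubic_T_def)

text \<open>If T vanished at q, it would vanish at every iterated square of q, contradicting T \<longlonglongrightarrow> 1.\<close>

lemma cubic_T_pos: "cubic_T q > 0"
proof (rule ccontr)
  assume "\<not> cubic_T q > 0"
  then have 0: "cubic_T q = 0" using cubic_T_nonneg by simp
  have "cubic_T (q ^ 2 ^ n) = 0" for n
  proof (induction n)
    case (Suc n)
    show ?case
      using nome.cubic_T_relation[OF nome_iterate[of n]] Suc
      by (simp add: mult.commute flip: power_mult)
  qed (simp add: 0)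
  then show False
    using cubic_T_iterate_tendsto by (simp add: LIMSEQ_const_iff)
qed

section \<open>The chain of moduli and its asymptotics\<close>

definition cubic_modulus :: "nat \<Rightarrow> real" where
  "cubic_modulus n = sqrt (cubic_modulus_sq (cubic_T (q ^ 2 ^ n)))"

lemma cubic_T_iterate_range: "0 < cubic_T (q ^ 2 ^ n)" "cubic_T (q ^ 2 ^ n) < 1"
  using nome.cubic_T_pos[OF nome_iterate] nome.cubic_T_less_1[OF nome_iterate] by auto

lemma cubic_modulus_range: "0 < cubic_modulus n" "cubic_modulus n < 1"
  using cubic_modulus_sq_range[OF cubic_T_iterate_range] by (auto simp: cubic_modulus_def)

lemma cubic_modulus_squared: "(cubic_modulus n)\<^sup>2 = cubic_modulus_sq (cubic_T (q ^ 2 ^ n))"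
  using cubic_modulus_sq_range[OF cubic_T_iterate_range, of n] by (simp add: cubic_modulus_def)

lemma cubic_modulus_Suc:
  "cubic_modulus (Suc n) = (1 - sqrt (1 - (cubic_modulus n)\<^sup>2)) / (1 + sqrt (1 - (cubic_modulus n)\<^sup>2))"
proof -
  have "(cubic_T (q ^ 2 ^ Suc n))\<^sup>2 * (1 + cubic_T (q ^ 2 ^ n)) = cubic_T (q ^ 2 ^ n) * (3 - cubic_T (q ^ 2 ^ n))"
    using nome.cubic_T_relation[OF nome_iterate[of n]] by (simp add: mult.commute flip: power_mult)
  from cubic_modulus_landen[OF cubic_T_iterate_range cubic_T_iterate_range this]
  show ?thesis
    unfolding cubic_modulus_squared by (simp add: cubic_modulus_def)
qed

lemma cubic_modulus_tendsto: "cubic_modulus \<longlonglongrightarrow> 0"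
proof -
  have "(\<lambda>n. sqrt (cubic_modulus_sq (cubic_T (q ^ 2 ^ n)))) \<longlonglongrightarrow>
      sqrt (((1 - 1) * (3 + 1) ^ 3) / ((1 + 1) * (3 - 1) ^ 3))"
    unfolding cubic_modulus_sq_def by (intro tendsto_intros cubic_T_iterate_tendsto) auto
  then show ?thesis by (simp add: cubic_modulus_def[abs_def])
qed

text \<open>Only the factor 1 - T of the squared modulus vanishes in the limit. Since (1 - T)(1 + T)
  = 8 V^3, it contains q^(2^n) exactly, and the cofactor \<open>G\<close> tends to 16; its logarithm
  is therefore negligible against 2^n.\<close>

lemma cubic_modulus_log_tendsto: "(\<lambda>n. ln (cubic_modulus n) / 2 ^ n) \<longlonglongrightarrow> ln q / 2"
proof -
  define t where "t = (\<lambda>n. cubic_T (q ^ 2 ^ n))"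
  define \<rho> where "\<rho> = (\<lambda>n. (cubic_theta (q ^ 2 ^ n) 1 / cubic_theta (q ^ 2 ^ n) 0) ^ 3)"
  define G where "G = (\<lambda>n. 8 * \<rho> n / (1 + t n) * ((3 + t n) ^ 3 / ((1 + t n) * (3 - t n) ^ 3)))"
  have t: "0 < t n" "t n < 1" for n
    using cubic_T_iterate_range by (auto simp: t_def)
  have \<rho>: "\<rho> n > 0" for n
    using nome.cubic_theta_0_pos[OF nome_iterate[of n]] nome.cubic_theta_1_pos[OF nome_iterate[of n]]
    by (simp add: \<rho>_def)
  have G: "G n > 0" for n
    using t[of n] \<rho>[of n] by (simp add: G_def)
  have sq: "(cubic_modulus n)\<^sup>2 = q ^ 2 ^ n * G n" for n
  proof -
    have "(t n)\<^sup>2 = 1 - 8 * cubic_cfrac (q ^ 2 ^ n) ^ 3"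
      using nome.cubic_T_eq[OF nome_iterate[of n]] by (simp add: t_def cubic_T_def)
    then have "(1 - t n) * (1 + t n) = 8 * (q ^ 2 ^ n * \<rho> n)"
      unfolding nome.cubic_cfrac_cube[OF nome_iterate] \<rho>_def by (simp add: power2_eq_square algebra_simps)
    then have "1 - t n = q ^ 2 ^ n * (8 * \<rho> n / (1 + t n))"
      using t[of n] by (simp add: field_simps)
    then have "(1 - t n) * (3 + t n) ^ 3 / ((1 + t n) * (3 - t n) ^ 3) = q ^ 2 ^ n * G n"
      unfolding G_def by (simp only:) (simp add: mult_ac)
    then show ?thesis
      by (simp add: cubic_modulus_squared cubic_modulus_sq_def t_def)
  qed
  have "ln (cubic_modulus n) / 2 ^ n = ln q / 2 + ln (G n) / 2 / 2 ^ n" for n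
  proof -
    have "2 * ln (cubic_modulus n) = ln ((cubic_modulus n)\<^sup>2)"
      using cubic_modulus_range[of n] by (simp add: ln_realpow)
    also have "\<dots> = 2 ^ n * ln q + ln (G n)"
      unfolding sq using q0 G[of n] by (simp add: ln_mult ln_realpow)
    finally show ?thesis by (simp add: field_simps)
  qed
  moreover have "(\<lambda>n. ln q / 2 + ln (G n) / 2 / 2 ^ n) \<longlonglongrightarrow> ln q / 2 + 0"
  proof (intro tendsto_intros)
    have "G \<longlonglongrightarrow> 8 * 1 / (1 + 1) * ((3 + 1) ^ 3 / ((1 + 1) * (3 - 1) ^ 3))"
      unfolding G_def \<rho>_def t_def
      by (intro tendsto_intros cubic_ratio_iterate_tendsto cubic_T_iterate_tendsto) auto
    then have "(\<lambda>n. ln (G n) / 2) \<longlonglongrightarrow> ln 16 / 2"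
      by (intro tendsto_intros) auto
    moreover have "filterlim (\<lambda>n. 2 ^ n :: real) at_infinity sequentially"
      by (rule filterlim_realpow_sequentially_gt1) simp
    ultimately show "(\<lambda>n. ln (G n) / 2 / 2 ^ n) \<longlonglongrightarrow> 0"
      by (rule tendsto_divide_0)
  qed
  ultimately show ?thesis by simp
qed

lemma ell_ratio_cubic_modulus: "ell_ratio (cubic_modulus 0) = - ln q / pi"
  using ell_ratio_eq_log[OF cubic_modulus_range cubic_modulus_Suc cubic_modulus_tendsto
      cubic_modulus_log_tendsto] by simp

end

theorem theorem4p1:
  fixes r q T :: real
  assumes "r > 0"
    and "q = exp (- pi * sqrt r)"
    and "T = sqrt (1 - 8 * cubic_cfrac q ^ 3)"
  shows "(singular_modulus r)\<^sup>2 = ((1 - T) * (3 + T) ^ 3) / ((1 + T) * (3 - T) ^ 3)"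
proof -
  interpret nome q
    by unfold_locales (use assms in simp_all)
  have "ln q = - pi * sqrt r"
    by (simp add: assms(2))
  then have "ell_ratio (cubic_modulus 0) = sqrt r"
    by (simp add: ell_ratio_cubic_modulus)
  then have "singular_modulus r = cubic_modulus 0"
    by (rule singular_modulus_eqI[OF cubic_modulus_range])
  then show ?thesis
    using assms(3) cubic_modulus_squared[of 0] by (simp add: cubic_modulus_sq_def cubic_T_def)
qed

end
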